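(* Let $t$ and $u$ be terms built from variables using the binary operations $\sqcap$ and $\times$. Then: (i) the inequality $t\le u$ is universally valid if and only if it is combinatorially valid, i.e. there is a total map $f: V_{\llbracket u\rrbracket}\to V_{\llbracket t\rrbracket}$ which is a reduction of $\llbracket t\rrbracket$ to $\llbracket u\rrbracket$; (ii) the inequality $t\le_\bullet u$ is universally valid if and only if it is combinatorially valid, i.e. there is a partial map $f: V_{\llbracket u\rrbracket}\rightharpoonup V_{\llbracket t\rrbracket}$ which is a $\bullet$-reduction of $\llbracket t\rrbracket$ to $\llbracket u\rrbracket$.
   Context: Weihrauch reducibility: for partial multivalued $f,g:\subseteq\{0,1\}^{\mathbb{N}}\rightrightarrows\{0,1\}^{\mathbb{N}}$, $f\le_W g$ iff there are computable partial $H$, $K$ with $H(x)\in\operatorname{dom}(g)$ for all $x\in\operatorname{dom}(f)$ and $K(x,y)$ defined and in $f(x)$ for all $y\in g(H(x))$. $\mathfrak{W}$ is the set of Weihrauch degrees. Operations (with $\langle\cdot,\cdot\rangle$ a computable pairing): $0p\in(f\sqcap g)(\langle q_0,q_1\rangle)$ if $p\in f(q_0)$, $1p\in(f\sqcap g)(\langle q_0,q_1\rangle)$ if $p\in g(q_1)$; $\langle p_0,p_1\rangle\in(f\times g)(\langle q_0,q_1\rangle)$ if $p_0\in f(q_0)$ and $p_1\in g(q_1)$. The degree $1$ is that of the identity on $\{0,1\}^{\mathbb{N}}$; a degree is pointed if it is $\ge_W 1$, equivalently its representatives have a computable point in their domain; $\mathfrak{W}_\bullet$ is the set of pointed degrees.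 An inequality $t\le u$ is universally valid if it holds (as $\le_W$) for every assignment of Weihrauch degrees to the variables; $t\le_\bullet u$ is universally valid if it holds for every assignment of pointed Weihrauch degrees to the variables. A (finite coloured undirected) graph is a triple $(V,E,c)$ with $V$ finite, $E\subseteq[V]^2$, and $c:V\to\mathcal{V}$ a colouring by variables. $G+H$ is the disjoint union, and $(V,E,c)^\bot=(V,[V]^2\setminus E,c)$. The graph $\llbracket t\rrbracket$ of a term is defined by: $\llbracket x\rrbracket$ is a single vertex coloured $x$; $\llbracket t\sqcap u\rrbracket=\llbracket t\rrbracket+\llbracket u\rrbracket$; $\llbracket t\times u\rrbracket=(\llbracket t\rrbracket^\bot+\llbracket u\rrbracket^\bot)^\bot$. Given graphs $G=(V_G,E_G,c_G)$, $H=(V_H,E_H,c_H)$, a partial map $f:V_H\rightharpoonup V_G$ is a $\bullet$-reduction of $G$ to $H$ if $c_G(f(v))=c_H(v)$ for all $v\in\operatorname{dom}(f)$ and for every maximal clique $M$ of $H$ the image $f(M)$ contains a maximal clique of $G$; if moreover $f$ is total it is a reduction.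
   Formalization: The meet f ⊓ g is taken with the standard domain dom(f) × dom(g); the two clauses read literally would also define it when only one component lies in its domain, and then x ⊓ y ≤ x would fail (for example x nowhere defined, y the identity). *)

theory Defs
  imports Main
begin

datatype recf = Zero | Succ | Proj nat | Comp recf "recf list"
  | PrimRec recf recf | Minim recf

inductive reval :: "recf \<Rightarrow> nat list \<Rightarrow> nat \<Rightarrow> bool" where
  "reval Zero xs 0"
| "reval Succ (x # xs) (Suc x)"
| "i < length xs \<Longrightarrow> reval (Proj i) xs (xs ! i)"
| "list_all2 (\<lambda>g y. reval g xs y) gs ys \<Longrightarrow> reval f ys z \<Longrightarrow> reval (Comp f gs) xs z"
| "reval f xs z \<Longrightarrow> reval (PrimRec f g) (0 # xs) z"
| "reval (PrimRec f g) (n # xs) r \<Longrightarrow> reval g (r # n # xs) z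
     \<Longrightarrow> reval (PrimRec f g) (Suc n # xs) z"
| "reval f (y # xs) 0 \<Longrightarrow> (\<forall>z<y. \<exists>v. v \<noteq> 0 \<and> reval f (z # xs) v)
     \<Longrightarrow> reval (Minim f) xs y"

definition computable_nat :: "(nat \<Rightarrow> nat) \<Rightarrow> bool" where
  "computable_nat h \<longleftrightarrow> (\<exists>r. \<forall>n. reval r [n] (h n))"

type_synonym cantor = "nat \<Rightarrow> bool"

text \<open>bijective coding of finite binary words by natural numbers\<close>
fun wcode :: "bool list \<Rightarrow> nat" where
  "wcode [] = 0"
| "wcode (b # w) = 2 * wcode w + (if b then 2 else 1)"

definition computable_word :: "(bool list \<Rightarrow> bool list) \<Rightarrow> bool" where
  "computable_word \<phi> \<longleftrightarrow> (\<exists>h. computable_nat h \<and> (\<forall>w. h (wcode w) = wcode (\<phi> w)))"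

definition prefix_of :: "cantor \<Rightarrow> nat \<Rightarrow> bool list" where
  "prefix_of x m = map x [0..<m]"

text \<open>A (total representation of a) partial function F on Cantor space is computable
  on the set D, i.e. its restriction to D is a computable partial function: some computable
  word function, fed with longer and longer prefixes of x, produces longer and longer
  prefixes of F x.\<close>
definition computable_on :: "cantor set \<Rightarrow> (cantor \<Rightarrow> cantor) \<Rightarrow> bool" where
  "computable_on D F \<longleftrightarrow> (\<exists>\<phi>. computable_word \<phi> \<and>
     (\<forall>x\<in>D. (\<forall>m i. i < length (\<phi> (prefix_of x m)) \<longrightarrow> \<phi> (prefix_of x m) ! i = F x i)
            \<and> (\<forall>n. \<exists>m. n \<le> length (\<phi> (prefix_of x m)))))"

definition cpair :: "cantor \<Rightarrow> cantor \<Rightarrow> cantor" where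
  "cpair p q = (\<lambda>n. if even n then p (n div 2) else q (n div 2))"

definition cfst :: "cantor \<Rightarrow> cantor" where "cfst z = (\<lambda>n. z (2 * n))"
definition csnd :: "cantor \<Rightarrow> cantor" where "csnd z = (\<lambda>n. z (2 * n + 1))"

definition ccons :: "bool \<Rightarrow> cantor \<Rightarrow> cantor" where
  "ccons b p = (\<lambda>n. if n = 0 then b else p (n - 1))"

text \<open>f x is the set of admissible outputs; dom f = inputs with a nonempty output set\<close>
type_synonym mvf = "cantor \<Rightarrow> cantor set"

definition mdom :: "mvf \<Rightarrow> cantor set" where
  "mdom f = {x. f x \<noteq> {}}"

definition W_le :: "mvf \<Rightarrow> mvf \<Rightarrow> bool" where
  "W_le f g \<longleftrightarrow> (\<exists>H K. computable_on (mdom f) H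
      \<and> computable_on {cpair x y | x y. x \<in> mdom f \<and> y \<in> g (H x)} K
      \<and> (\<forall>x\<in>mdom f. H x \<in> mdom g \<and> (\<forall>y\<in>g (H x). K (cpair x y) \<in> f x)))"

definition idW :: mvf where "idW x = {x}"

definition pointed :: "mvf \<Rightarrow> bool" where "pointed f \<longleftrightarrow> W_le idW f"

definition meetW :: "mvf \<Rightarrow> mvf \<Rightarrow> mvf" where
  "meetW f g z = (if cfst z \<in> mdom f \<and> csnd z \<in> mdom g
     then ccons False ` f (cfst z) \<union> ccons True ` g (csnd z) else {})"

definition timesW :: "mvf \<Rightarrow> mvf \<Rightarrow> mvf" where
  "timesW f g z = {cpair p0 p1 | p0 p1. p0 \<in> f (cfst z) \<and> p1 \<in> g (csnd z)}"

datatype 'v trm = Var 'v | Meet "'v trm" "'v trm" | Times "'v trm" "'v trm"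

fun evalW :: "('v \<Rightarrow> mvf) \<Rightarrow> 'v trm \<Rightarrow> mvf" where
  "evalW \<alpha> (Var x) = \<alpha> x"
| "evalW \<alpha> (Meet t u) = meetW (evalW \<alpha> t) (evalW \<alpha> u)"
| "evalW \<alpha> (Times t u) = timesW (evalW \<alpha> t) (evalW \<alpha> u)"

definition univ_valid :: "'v trm \<Rightarrow> 'v trm \<Rightarrow> bool" where
  "univ_valid t u \<longleftrightarrow> (\<forall>\<alpha>. W_le (evalW \<alpha> t) (evalW \<alpha> u))"

definition univ_valid_pointed :: "'v trm \<Rightarrow> 'v trm \<Rightarrow> bool" where
  "univ_valid_pointed t u \<longleftrightarrow>
     (\<forall>\<alpha>. (\<forall>x. pointed (\<alpha> x)) \<longrightarrow> W_le (evalW \<alpha> t) (evalW \<alpha> u))"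

text \<open>vertices are bool lists (tags for disjoint unions); edges are 2-element sets\<close>
record 'v cgraph =
  verts :: "bool list set"
  edges :: "bool list set set"
  col :: "bool list \<Rightarrow> 'v"

definition pairs2 :: "'a set \<Rightarrow> 'a set set" where
  "pairs2 V = {e. e \<subseteq> V \<and> card e = 2}"

definition gplus :: "'v cgraph \<Rightarrow> 'v cgraph \<Rightarrow> 'v cgraph" where
  "gplus G H = \<lparr> verts = Cons False ` verts G \<union> Cons True ` verts H,
     edges = image (Cons False) ` edges G \<union> image (Cons True) ` edges H,
     col = (\<lambda>v. case v of False # w \<Rightarrow> col G w | True # w \<Rightarrow> col H w
                          | [] \<Rightarrow> undefined) \<rparr>"

definition gcompl :: "'v cgraph \<Rightarrow> 'v cgraph" where
  "gcompl G = \<lparr> verts = verts G, edges = pairs2 (verts G) - edges G, col = col G \<rparr>"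

fun tgraph :: "'v trm \<Rightarrow> 'v cgraph" where
  "tgraph (Var x) = \<lparr> verts = {[]}, edges = {}, col = (\<lambda>_. x) \<rparr>"
| "tgraph (Meet t u) = gplus (tgraph t) (tgraph u)"
| "tgraph (Times t u) = gcompl (gplus (gcompl (tgraph t)) (gcompl (tgraph u)))"

definition is_clique :: "'v cgraph \<Rightarrow> bool list set \<Rightarrow> bool" where
  "is_clique G C \<longleftrightarrow> C \<subseteq> verts G \<and> (\<forall>a\<in>C. \<forall>b\<in>C. a \<noteq> b \<longrightarrow> {a, b} \<in> edges G)"

definition max_clique :: "'v cgraph \<Rightarrow> bool list set \<Rightarrow> bool" where
  "max_clique G C \<longleftrightarrow> is_clique G C \<and> (\<forall>C'. is_clique G C' \<and> C \<subseteq> C' \<longrightarrow> C' = C)"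

definition bullet_reduction ::
  "'v cgraph \<Rightarrow> 'v cgraph \<Rightarrow> (bool list \<rightharpoonup> bool list) \<Rightarrow> bool" where
  "bullet_reduction G H f \<longleftrightarrow>
     dom f \<subseteq> verts H \<and> ran f \<subseteq> verts G
     \<and> (\<forall>v\<in>dom f. col G (the (f v)) = col H v)
     \<and> (\<forall>M. max_clique H M \<longrightarrow>
          (\<exists>C. max_clique G C \<and> C \<subseteq> {w. \<exists>v\<in>M. f v = Some w}))"

definition reduction ::
  "'v cgraph \<Rightarrow> 'v cgraph \<Rightarrow> (bool list \<rightharpoonup> bool list) \<Rightarrow> bool" where
  "reduction G H f \<longleftrightarrow> bullet_reduction G H f \<and> dom f = verts H"

end

theory Submission
  imports Defs "HOL-Library.Countable_Set"
begin

text \<open>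
  A solution of an instance of a term amounts to a maximal clique of its graph together with a
  solution for each vertex of that clique. A reduction \<open>f\<close> therefore yields a Weihrauch reduction
  that merely reroutes bits: \<open>H\<close> sends to the vertex \<open>v\<close> of \<open>u\<close> the instance at \<open>f v\<close>, or a
  computable point where \<open>f\<close> is undefined, and \<open>K\<close> reads off the clique \<open>M\<close> from finitely many bits
  and outputs the solutions belonging to a maximal clique of \<open>t\<close> inside \<open>f(M)\<close>.

  Conversely, take Cohen generic points \<open>Q v\<close>, one per vertex \<open>v\<close> of \<open>t\<close>, none of them computable
  from the others, and let the variable \<open>x\<close> denote the problem whose instances are names of the
  \<open>x\<close>-coloured vertices \<open>v\<close> of \<open>t\<close>, with unique solution \<open>Q v\<close> (plus one trivial instance in the
  pointed case). Applied to the tuple of all names, \<open>H\<close> picks for each vertex of \<open>u\<close> a vertex of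
  \<open>t\<close> or the trivial instance, which defines \<open>f\<close>. By independence \<open>K\<close> can only produce \<open>Q v\<close>
  when \<open>v\<close> lies in \<open>f(M)\<close>.
\<close>

section \<open>Recursive functions\<close>

text \<open>Total functions of fixed arity take the place of programs, so that recursiveness follows
  from closure rules; lists of any other length are unconstrained.\<close>

definition comp_fn :: "nat \<Rightarrow> (nat list \<Rightarrow> nat) \<Rightarrow> bool" where
  "comp_fn k F \<longleftrightarrow> (\<exists>r. \<forall>xs. length xs = k \<longrightarrow> reval r xs (F xs))"

lemma comp_fn_cong:
  "comp_fn k F \<Longrightarrow> (\<And>xs. length xs = k \<Longrightarrow> F xs = G xs) \<Longrightarrow> comp_fn k G"
  unfolding comp_fn_def by metis

lemma comp_fn_nth: "i < k \<Longrightarrow> comp_fn k (\<lambda>xs. xs ! i)"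
  unfolding comp_fn_def by (metis reval.intros(3))

lemma comp_fn_subst_list:
  assumes F: "comp_fn (length Gs) F" and Gs: "\<forall>G\<in>set Gs. comp_fn k G"
  shows "comp_fn k (\<lambda>xs. F (map (\<lambda>G. G xs) Gs))"
proof -
  obtain r where r: "\<And>ys. length ys = length Gs \<Longrightarrow> reval r ys (F ys)"
    using F unfolding comp_fn_def by blast
  have "\<forall>G\<in>set Gs. \<exists>s. \<forall>xs. length xs = k \<longrightarrow> reval s xs (G xs)"
    using Gs unfolding comp_fn_def .
  then obtain S where S: "\<And>G xs. G \<in> set Gs \<Longrightarrow> length xs = k \<Longrightarrow> reval (S G) xs (G xs)"
    by metis
  have "reval (Comp r (map S Gs)) xs (F (map (\<lambda>G. G xs) Gs))" if "length xs = k" for xs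
  proof (rule reval.intros(4))
    show "list_all2 (\<lambda>g y. reval g xs y) (map S Gs) (map (\<lambda>G. G xs) Gs)"
      using S that by (auto simp: list_all2_conv_all_nth)
    show "reval r (map (\<lambda>G. G xs) Gs) (F (map (\<lambda>G. G xs) Gs))"
      by (rule r) simp
  qed
  then show ?thesis unfolding comp_fn_def by blast
qed

lemma comp_fn_subst1:
  assumes "comp_fn 1 (\<lambda>xs. f (xs ! 0))" "comp_fn k A"
  shows "comp_fn k (\<lambda>xs. f (A xs))"
  using comp_fn_subst_list[of "[A]" "\<lambda>xs. f (xs ! 0)" k] assms by simp

lemma comp_fn_subst2:
  assumes "comp_fn 2 (\<lambda>xs. f (xs ! 0) (xs ! 1))" "comp_fn k A" "comp_fn k B"
  shows "comp_fn k (\<lambda>xs. f (A xs) (B xs))"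
  using comp_fn_subst_list[of "[A, B]" "\<lambda>xs. f (xs ! 0) (xs ! 1)" k] assms
  by (simp add: numeral_2_eq_2)

lemma comp_fn_zero: "comp_fn k (\<lambda>_. 0)"
  unfolding comp_fn_def using reval.intros(1) by blast

lemma comp_fn_Suc:
  assumes "comp_fn k A" shows "comp_fn k (\<lambda>xs. Suc (A xs))"
proof (rule comp_fn_subst1[OF _ assms])
  have "reval Succ xs (Suc (xs ! 0))" if "length xs = 1" for xs
    using that reval.intros(2)[of "xs ! 0" "[]"] by (cases xs) auto
  then show "comp_fn 1 (\<lambda>xs. Suc (xs ! 0))" unfolding comp_fn_def by blast
qed

lemma comp_fn_const: "comp_fn k (\<lambda>_. n)"
  by (induction n) (auto intro: comp_fn_zero comp_fn_Suc)

lemma map_nth_projections: "length xs = k \<Longrightarrow> map (\<lambda>G. G xs) (map (\<lambda>i xs. xs ! i) [0..<k]) = xs"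
  by (simp add: comp_def) (metis map_nth)

text \<open>\<open>PrimRec\<close> recurses on the head of its argument list. Substituting
  \<open>N\<close> for that head and projections for the remaining arguments gives recursion up to a
  computed bound.\<close>

lemma comp_fn_rec:
  assumes N: "comp_fn k N" and f: "comp_fn k f" and g: "comp_fn (k + 2) g"
  shows "comp_fn k (\<lambda>xs. rec_nat (f xs) (\<lambda>n r. g (r # n # xs)) (N xs))"
proof -
  let ?R = "\<lambda>ys. rec_nat (f (tl ys)) (\<lambda>n r. g (r # n # tl ys)) (hd ys)"
  obtain rf where rf: "\<And>xs. length xs = k \<Longrightarrow> reval rf xs (f xs)"
    using f unfolding comp_fn_def by blast
  obtain rg where rg: "\<And>xs. length xs = k + 2 \<Longrightarrow> reval rg xs (g xs)"
    using g unfolding comp_fn_def by blast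
  have *: "reval (PrimRec rf rg) (n # xs) (?R (n # xs))" if "length xs = k" for n xs
  proof (induction n)
    case 0
    then show ?case using reval.intros(5)[OF rf[OF that]] by simp
  next
    case (Suc n)
    then show ?case
      using reval.intros(6)[OF Suc rg] that by simp
  qed
  have "reval (PrimRec rf rg) ys (?R ys)" if "length ys = Suc k" for ys
    using *[of "tl ys" "hd ys"] that by (cases ys) auto
  then have "comp_fn (Suc k) ?R" unfolding comp_fn_def by blast
  then have "comp_fn k (\<lambda>xs. ?R (map (\<lambda>G. G xs) (N # map (\<lambda>i xs. xs ! i) [0..<k])))"
    by (intro comp_fn_subst_list) (auto intro: N comp_fn_nth)
  then show ?thesis
    by (rule comp_fn_cong) (simp only: list.map list.sel map_nth_projections)
qed

text \<open>\<open>Minim\<close> demands a nonzero value at every smaller argument, which holds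
  because \<open>f\<close> is total there; \<open>ex\<close> makes the search end.\<close>

lemma comp_fn_Least:
  assumes f: "comp_fn (Suc k) f" and ex: "\<And>xs. length xs = k \<Longrightarrow> \<exists>y. f (y # xs) = 0"
  shows "comp_fn k (\<lambda>xs. LEAST y. f (y # xs) = 0)"
proof -
  obtain r where r: "\<And>xs. length xs = Suc k \<Longrightarrow> reval r xs (f xs)"
    using f unfolding comp_fn_def by blast
  have "reval (Minim r) xs (LEAST y. f (y # xs) = 0)" if "length xs = k" for xs
  proof (rule reval.intros(7))
    show "reval r ((LEAST y. f (y # xs) = 0) # xs) 0"
      using r[of "(LEAST y. f (y # xs) = 0) # xs"] LeastI_ex[OF ex[OF that]] that by simp
    show "\<forall>z<LEAST y. f (y # xs) = 0. \<exists>v. v \<noteq> 0 \<and> reval r (z # xs) v"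
      using r that by (metis length_Cons not_less_Least)
  qed
  then show ?thesis unfolding comp_fn_def by blast
qed

text \<open>Recursion and minimisation put new arguments in front of the list; dropping them lets a
  function of the old arguments be used under the new ones.\<close>

lemma comp_fn_drop:
  assumes "comp_fn k F" shows "comp_fn (k + j) (\<lambda>ys. F (drop j ys))"
proof -
  have "comp_fn (k + j) (\<lambda>ys. F (map (\<lambda>G. G ys) (map (\<lambda>i ys. ys ! (j + i)) [0..<k])))"
    by (intro comp_fn_subst_list) (auto intro: assms comp_fn_nth)
  then show ?thesis
  proof (rule comp_fn_cong)
    fix xs :: "nat list" assume "length xs = k + j"
    then have "map (\<lambda>G. G xs) (map (\<lambda>i ys. ys ! (j + i)) [0..<k]) = drop j xs"
      by (intro nth_equalityI) auto
    then show "F (map (\<lambda>G. G xs) (map (\<lambda>i ys. ys ! (j + i)) [0..<k])) = F (drop j xs)"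
      by simp
  qed
qed

text \<open>Recursion up to \<open>A xs\<close> with a step that ignores the counter and the
  previous value: zero rounds leave \<open>B xs\<close>, any positive number of rounds gives
  \<open>C xs\<close>.\<close>

lemma comp_fn_if_zero:
  assumes "comp_fn k A" "comp_fn k B" "comp_fn k C"
  shows "comp_fn k (\<lambda>xs. if A xs = 0 then B xs else C xs)"
proof -
  have "comp_fn k (\<lambda>xs. rec_nat (B xs) (\<lambda>n r. C (drop 2 (r # n # xs))) (A xs))"
    by (intro comp_fn_rec[where g = "\<lambda>ys. C (drop 2 ys)"] comp_fn_drop assms)
  then show ?thesis
    by (rule comp_fn_cong) (auto simp: gr0_conv_Suc split: nat.split)
qed

section \<open>Arithmetic by primitive recursion and bounded search\<close>

lemma comp_fn_add:
  assumes "comp_fn k A" "comp_fn k B" shows "comp_fn k (\<lambda>xs. A xs + B xs)"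
proof -
  have "comp_fn k (\<lambda>xs. rec_nat (B xs) (\<lambda>n r. Suc ((r # n # xs) ! 0)) (A xs))"
    by (intro comp_fn_rec[where g = "\<lambda>ys. Suc (ys ! 0)"] comp_fn_Suc comp_fn_nth assms) simp
  moreover have "rec_nat b (\<lambda>n r. Suc r) a = a + b" for a b by (induction a) auto
  ultimately show ?thesis by simp
qed

lemma comp_fn_mult:
  assumes "comp_fn k A" "comp_fn k B" shows "comp_fn k (\<lambda>xs. A xs * B xs)"
proof -
  have "comp_fn k (\<lambda>xs. rec_nat 0 (\<lambda>n r. (r # n # xs) ! 0 + B (drop 2 (r # n # xs))) (A xs))"
    by (intro comp_fn_rec[where g = "\<lambda>ys. ys ! 0 + B (drop 2 ys)"] comp_fn_add comp_fn_nth
        comp_fn_drop comp_fn_zero assms) simp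
  moreover have "rec_nat 0 (\<lambda>n r. r + b) a = a * b" for a b by (induction a) auto
  ultimately show ?thesis by simp
qed

lemma comp_fn_pred:
  assumes "comp_fn k A" shows "comp_fn k (\<lambda>xs. A xs - 1)"
proof -
  have "comp_fn k (\<lambda>xs. rec_nat 0 (\<lambda>n r. (r # n # xs) ! 1) (A xs))"
    by (intro comp_fn_rec[where g = "\<lambda>ys. ys ! 1"] comp_fn_nth comp_fn_zero assms) simp
  moreover have "rec_nat 0 (\<lambda>n r. n) a = a - 1" for a by (cases a) auto
  ultimately show ?thesis by simp
qed

lemma comp_fn_diff:
  assumes "comp_fn k A" "comp_fn k B" shows "comp_fn k (\<lambda>xs. A xs - B xs)"
proof -
  have "comp_fn k (\<lambda>xs. rec_nat (A xs) (\<lambda>n r. (r # n # xs) ! 0 - 1) (B xs))"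
    by (intro comp_fn_rec[where g = "\<lambda>ys. ys ! 0 - 1"] comp_fn_pred comp_fn_nth assms) simp
  moreover have "rec_nat a (\<lambda>n r. r - 1) b = a - b" for a b by (induction b) auto
  ultimately show ?thesis by simp
qed

lemma comp_fn_power2:
  assumes "comp_fn k A" shows "comp_fn k (\<lambda>xs. 2 ^ A xs)"
proof -
  have "comp_fn k (\<lambda>xs. rec_nat 1 (\<lambda>n r. (r # n # xs) ! 0 + (r # n # xs) ! 0) (A xs))"
    by (intro comp_fn_rec[where g = "\<lambda>ys. ys ! 0 + ys ! 0"] comp_fn_add comp_fn_nth
        comp_fn_const assms) simp_all
  moreover have "rec_nat 1 (\<lambda>n r. r + r) a = (2::nat) ^ a" for a by (induction a) auto
  ultimately show ?thesis by simp
qed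

lemma comp_fn_div:
  assumes A: "comp_fn k A" and B: "comp_fn k B" and pos: "\<And>xs. B xs > 0"
  shows "comp_fn k (\<lambda>xs. A xs div B xs)"
proof -
  \<comment> \<open>By truncated subtraction, \<open>?f (q # xs) = 0\<close> says
    \<open>A xs < B xs * (q + 1)\<close>; the least such \<open>q\<close> is the quotient.\<close>
  let ?f = "\<lambda>ys. Suc (A (drop 1 ys)) - B (drop 1 ys) * Suc (ys ! 0)"
  have eq: "(LEAST q. ?f (q # xs) = 0) = A xs div B xs" for xs
  proof (rule Least_equality)
    show "?f (A xs div B xs # xs) = 0"
      using pos[of xs] dividend_less_times_div[of "B xs" "A xs"] by (simp add: algebra_simps)
    show "A xs div B xs \<le> y" if "?f (y # xs) = 0" for y
      using that pos[of xs]
      by (metis One_nat_def Suc_leI diff_is_0_eq drop0 drop_Suc_Cons leD less_Suc_eq_le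
          less_mult_imp_div_less linorder_not_le mult.commute nth_Cons_0 zero_less_diff)
  qed
  have "\<exists>y. ?f (y # xs) = 0" for xs
    \<comment> \<open>As \<open>B xs\<close> is at least 1, already \<open>q = A xs\<close>
      satisfies the inequality.\<close>
    using pos[of xs] by (intro exI[of _ "A xs"]) (simp, metis One_nat_def Suc_leI mult_le_mono1 mult_1 mult_Suc_right)
  then have "comp_fn k (\<lambda>xs. LEAST q. ?f (q # xs) = 0)"
    using A B comp_fn_drop[of k _ 1]
    by (intro comp_fn_Least comp_fn_diff comp_fn_mult comp_fn_Suc comp_fn_nth) auto
  then show ?thesis unfolding eq .
qed

lemma comp_fn_mod2:
  assumes "comp_fn k A" shows "comp_fn k (\<lambda>xs. A xs mod 2)"
proof -
  have "comp_fn k (\<lambda>xs. A xs - 2 * (A xs div 2))"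
    by (intro comp_fn_diff comp_fn_mult comp_fn_div comp_fn_const assms) simp
  then show ?thesis by (rule comp_fn_cong) (simp add: minus_mult_div_eq_mod)
qed

lemma computable_nat_iff_comp_fn: "computable_nat h \<longleftrightarrow> comp_fn 1 (\<lambda>xs. h (xs ! 0))"
proof
  assume "computable_nat h"
  then obtain r where "\<And>n. reval r [n] (h n)" unfolding computable_nat_def by blast
  then have "reval r xs (h (xs ! 0))" if "length xs = 1" for xs
    using that by (cases xs) auto
  then show "comp_fn 1 (\<lambda>xs. h (xs ! 0))" unfolding comp_fn_def by blast
next
  assume "comp_fn 1 (\<lambda>xs. h (xs ! 0))"
  then obtain r where "\<And>xs. length xs = 1 \<Longrightarrow> reval r xs (h (xs ! 0))"
    unfolding comp_fn_def by blast
  from this[of "[_]"] show "computable_nat h" unfolding computable_nat_def by auto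
qed

section \<open>Bitwise computable functions on Cantor space\<close>

text \<open>In binary, \<open>wval w\<close> is a leading 1 above the bits of \<open>w\<close>, the head of \<open>w\<close> being the least
  significant bit, so single bits of \<open>w\<close> can be read off arithmetically.\<close>
definition wval :: "bool list \<Rightarrow> nat" where
  "wval w = Suc (wcode w)"

lemma wval_Nil [simp]: "wval [] = 1"
  and wval_Cons [simp]: "wval (b # w) = 2 * wval w + of_bool b"
  by (auto simp: wval_def)

lemma wval_bounds: "2 ^ length w \<le> wval w" "wval w < 2 ^ Suc (length w)"
  by (induction w) auto

lemma wval_bit: "k < length w \<Longrightarrow> wval w div 2 ^ k mod 2 = of_bool (w ! k)"
proof (induction w arbitrary: k)
  case (Cons b w)
  have "(2 * wval w + of_bool b) div 2 ^ Suc j = wval w div 2 ^ j" for j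
    by (simp add: div_mult2_eq)
  then show ?case using Cons by (cases k) auto
qed simp

lemma wval_replicate_False: "wval (replicate m False) = 2 ^ m"
  by (induction m) auto

text \<open>The code 0 belongs to the empty word only; otherwise the parity of the code determines
  the head, and then the code of the tail is determined as well.\<close>

lemma inj_wcode: "inj wcode"
proof
  show "w = v" if "wcode w = wcode v" for w v
    using that
  proof (induction w arbitrary: v)
    case Nil
    then show ?case by (cases v) (auto split: if_splits)
  next
    case (Cons b w)
    then obtain c v' where v: "v = c # v'" by (cases v) (auto split: if_splits)
    with Cons.prems have "b = c \<and> wcode w = wcode v'" by (auto split: if_splits) presburger+
    with Cons.IH v show ?case by blast
  qed
qed

text \<open>The linear modulus lets the word function decide from the length of its
  argument alone how many output bits it may emit.\<close>
definition lin_computable :: "(cantor \<Rightarrow> cantor) \<Rightarrow> bool" where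
  "lin_computable F \<longleftrightarrow> (\<exists>g c. comp_fn 2 (\<lambda>xs. g (xs ! 0) (xs ! 1)) \<and>
     (\<forall>z i n. c * Suc i \<le> n \<longrightarrow> g i (wval (prefix_of z n)) = of_bool (F z i)))"

text \<open>On a word of length \<open>l\<close> the word function emits \<open>l div c\<close>
  bits, all of which the modulus guarantees to be correct. The work lies in computing the code of
  this output from the code of the word.\<close>

lemma lin_computable_imp_computable_on:
  assumes "lin_computable F"
  shows "computable_on D F"
proof -
  obtain g c0 where g: "comp_fn 2 (\<lambda>xs. g (xs ! 0) (xs ! 1))"
    and g0: "\<And>z i n. c0 * Suc i \<le> n \<Longrightarrow> g i (wval (prefix_of z n)) = of_bool (F z i)"
    using assms unfolding lin_computable_def by metis
  \<comment> \<open>The successor makes the modulus positive, so that division by \<open>c\<close>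
    is meaningful and the search defining \<open>N\<close> ends.\<close>
  define c where "c = Suc c0"
  have gF: "g i (wval (prefix_of z n)) = of_bool (F z i)" if "c * Suc i \<le> n" for z i n
    using that by (intro g0) (simp add: c_def)
  \<comment> \<open>For \<open>n = wcode w\<close> the number \<open>Suc (Suc n)\<close> is
    \<open>wval w + 1\<close>, which is at most \<open>2 ^ k\<close> exactly when
    \<open>length w < k\<close>. The search thus finds \<open>length w div c\<close>.\<close>
  define N where "N n = (LEAST y. Suc (Suc n) - 2 ^ (c * Suc y) = 0)" for n
  have N_wcode: "N (wcode w) = length w div c" for w
    unfolding N_def
  proof (rule Least_equality)
    have "length w < c * Suc (length w div c)"
      using dividend_less_times_div[of c "length w"] by (simp add: c_def)
    then have "(2::nat) ^ Suc (length w) \<le> 2 ^ (c * Suc (length w div c))"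
      by (intro power_increasing) auto
    then show "Suc (Suc (wcode w)) - 2 ^ (c * Suc (length w div c)) = 0"
      using wval_bounds(2)[of w] by (simp add: wval_def)
    show "length w div c \<le> y" if "Suc (Suc (wcode w)) - 2 ^ (c * Suc y) = 0" for y
    proof -
      have "(2::nat) ^ length w < 2 ^ (c * Suc y)"
        using that wval_bounds(1)[of w] unfolding wval_def by linarith
      then have "length w < c * Suc y" by (rule power_less_imp_less_exp[rotated]) simp
      then have "length w div c < Suc y" by (metis less_mult_imp_div_less mult.commute)
      then show ?thesis by simp
    qed
  qed
  \<comment> \<open>The output is built from its last bit to its first: 1 is the value of the empty
    word, and doubling and adding a bit prepends that bit.\<close>
  define V where "V n = rec_nat 1 (\<lambda>k v. 2 * v + g (N n - 1 - k) (Suc n)) (N n)" for n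
  define \<phi> where "\<phi> w = map (\<lambda>i. g i (wval w) = 1) [0..<length w div c]" for w
  \<comment> \<open>Every word is a prefix of some point, so within the modulus \<open>g\<close>
    takes only the values 0 and 1 on it; otherwise the sum in \<open>V\<close> would not be a binary
    word.\<close>
  have out: "g i (wval w) = of_bool (g i (wval w) = 1)" if "i < length w div c" for i w
  proof -
    have "c * Suc i \<le> length w"
      using that by (metis Suc_leI mult.commute mult_le_mono1 div_times_less_eq_dividend le_trans)
    moreover have "w = prefix_of (\<lambda>i. w ! i) (length w)"
      by (simp add: prefix_of_def map_nth)
    ultimately have "g i (wval w) = of_bool (w = w \<and> F (\<lambda>i. w ! i) i)"
      using gF by metis
    then show ?thesis by simp
  qed
  have N_comp: "comp_fn 1 (\<lambda>xs. N (xs ! 0))"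
  proof -
    have "\<exists>y. Suc (Suc n) - 2 ^ (c * Suc y) = 0" for n
    proof
      have "Suc n < 2 ^ Suc n" by (rule less_exp)
      also have "(2::nat) ^ Suc n \<le> 2 ^ (c * Suc n)"
        by (intro power_increasing) (auto simp: c_def)
      finally show "Suc (Suc n) - 2 ^ (c * Suc n) = 0" by simp
    qed
    then have "comp_fn 1 (\<lambda>xs. LEAST y. Suc (Suc ((y # xs) ! 1)) - 2 ^ (c * Suc ((y # xs) ! 0)) = 0)"
      by (intro comp_fn_Least comp_fn_diff comp_fn_power2 comp_fn_mult comp_fn_const comp_fn_Suc
          comp_fn_nth) auto
    then show ?thesis by (simp add: N_def)
  qed
  have "comp_fn 1 (\<lambda>xs. rec_nat 1 (\<lambda>k v. 2 * (v # k # xs) ! 0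
     + g (N ((v # k # xs) ! 2) - 1 - (v # k # xs) ! 1) (Suc ((v # k # xs) ! 2))) (N (xs ! 0)))"
    by (intro comp_fn_rec[where g = "\<lambda>ys. 2 * ys ! 0 + g (N (ys ! 2) - 1 - ys ! 1) (Suc (ys ! 2))"]
        comp_fn_add comp_fn_mult comp_fn_const comp_fn_nth comp_fn_subst2[OF g] comp_fn_Suc
        comp_fn_diff comp_fn_subst1[OF N_comp]) auto
  then have "comp_fn 1 (\<lambda>xs. V (xs ! 0))" by (simp add: V_def numeral_2_eq_2)
  then have "computable_nat (\<lambda>n. V n - 1)"
    unfolding computable_nat_iff_comp_fn by (rule comp_fn_pred)
  moreover have "V (wcode w) = wval (\<phi> w)" for w
  proof -
    let ?N = "length w div c"
    have "rec_nat 1 (\<lambda>k v. 2 * v + g (?N - 1 - k) (wval w)) j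
        = wval (map (\<lambda>i. g i (wval w) = 1) [?N - j..<?N])" if "j \<le> ?N" for j
      using that
    proof (induction j)
      case (Suc j)
      then have "[?N - Suc j..<?N] = (?N - 1 - j) # [?N - j..<?N]"
        by (subst upt_conv_Cons) (auto simp: Suc_diff_Suc)
      then show ?case using Suc out[of "?N - 1 - j" w] by simp
    qed simp
    from this[of ?N] show ?thesis unfolding V_def N_wcode \<phi>_def wval_def by simp
  qed
  ultimately have "computable_word \<phi>"
    unfolding computable_word_def by (intro exI[of _ "\<lambda>n. V n - 1"]) (simp add: wval_def)
  moreover have "\<phi> (prefix_of x m) ! i = F x i" if "i < length (\<phi> (prefix_of x m))" for x m i
  proof -
    have "i < m div c" using that by (simp add: \<phi>_def prefix_of_def)
    then have "c * Suc i \<le> m"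
      by (metis Suc_leI mult.commute mult_le_mono1 div_times_less_eq_dividend le_trans)
    then show ?thesis using that gF[of i m x] by (simp add: \<phi>_def)
  qed
  moreover have "n \<le> length (\<phi> (prefix_of x (c * n)))" for x n
    by (simp add: \<phi>_def prefix_of_def c_def del: mult_Suc)
  ultimately show ?thesis unfolding computable_on_def by blast
qed

section \<open>Rerouting, interleaving and branching on bits\<close>

lemma lin_computable_affine: "lin_computable (\<lambda>z i. z (a * i + b))"
  unfolding lin_computable_def
proof (intro exI conjI allI impI)
  show "comp_fn 2 (\<lambda>xs. xs ! 1 div 2 ^ (a * xs ! 0 + b) mod 2)"
    by (intro comp_fn_mod2 comp_fn_div comp_fn_power2 comp_fn_add comp_fn_mult comp_fn_const
        comp_fn_nth) auto
  \<comment> \<open>The modulus \<open>a + b + 1\<close> works because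
    \<open>a * i + b < (a + b + 1) * (i + 1)\<close>.\<close>
  fix z :: cantor and i n assume "Suc (a + b) * Suc i \<le> n"
  then have "a * i + b < n" by (simp add: algebra_simps)
  then show "wval (prefix_of z n) div 2 ^ (a * i + b) mod 2 = of_bool (z (a * i + b))"
    by (subst wval_bit) (auto simp: prefix_of_def)
qed

lemma lin_computable_const:
  assumes "comp_fn 1 (\<lambda>xs. of_bool (p (xs ! 0)))"
  shows "lin_computable (\<lambda>_. p)"
  unfolding lin_computable_def
proof (intro exI conjI allI impI)
  show "comp_fn 2 (\<lambda>xs. of_bool (p (xs ! 0)))"
    using comp_fn_subst1[of "\<lambda>i. of_bool (p i)", OF assms] comp_fn_nth[of 0 2] by simp
qed (rule refl)

lemma lin_computable_cpair:
  assumes "lin_computable F" "lin_computable G"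
  shows "lin_computable (\<lambda>z. cpair (F z) (G z))"
proof -
  obtain f c where f: "comp_fn 2 (\<lambda>xs. f (xs ! 0) (xs ! 1))"
    and fF: "\<And>z i n. c * Suc i \<le> n \<Longrightarrow> f i (wval (prefix_of z n)) = of_bool (F z i)"
    using assms(1) unfolding lin_computable_def by metis
  obtain g d where g: "comp_fn 2 (\<lambda>xs. g (xs ! 0) (xs ! 1))"
    and gG: "\<And>z i n. d * Suc i \<le> n \<Longrightarrow> g i (wval (prefix_of z n)) = of_bool (G z i)"
    using assms(2) unfolding lin_computable_def by metis
  show ?thesis
    unfolding lin_computable_def
  proof (intro exI conjI allI impI)
    show "comp_fn 2 (\<lambda>xs. if xs ! 0 mod 2 = 0 then f (xs ! 0 div 2) (xs ! 1)
        else g (xs ! 0 div 2) (xs ! 1))"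
      by (intro comp_fn_if_zero comp_fn_mod2 comp_fn_subst2[OF f] comp_fn_subst2[OF g]
          comp_fn_div comp_fn_const comp_fn_nth) auto
    fix z i n assume n: "(c + d) * Suc i \<le> n"
    have "c * Suc (i div 2) \<le> c * Suc i" "d * Suc (i div 2) \<le> d * Suc i"
      by (intro mult_le_mono2; simp)+
    then have "c * Suc (i div 2) \<le> n" "d * Suc (i div 2) \<le> n"
      using n unfolding add_mult_distrib by linarith+
    then show "(if i mod 2 = 0 then f (i div 2) (wval (prefix_of z n))
        else g (i div 2) (wval (prefix_of z n))) = of_bool (cpair (F z) (G z) i)"
      using fF gG by (auto simp: cpair_def even_iff_mod_2_eq_zero)
  qed
qed

lemma lin_computable_ccons:
  assumes "lin_computable F"
  shows "lin_computable (\<lambda>z. ccons b (F z))"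
proof -
  obtain f c where f: "comp_fn 2 (\<lambda>xs. f (xs ! 0) (xs ! 1))"
    and fF: "\<And>z i n. c * Suc i \<le> n \<Longrightarrow> f i (wval (prefix_of z n)) = of_bool (F z i)"
    using assms unfolding lin_computable_def by metis
  show ?thesis
    unfolding lin_computable_def
  proof (intro exI conjI allI impI)
    show "comp_fn 2 (\<lambda>xs. if xs ! 0 = 0 then of_bool b else f (xs ! 0 - 1) (xs ! 1))"
      by (intro comp_fn_if_zero comp_fn_subst2[OF f] comp_fn_pred comp_fn_const comp_fn_nth) auto
    fix z i n assume n: "c * Suc i \<le> n"
    have "c * Suc (i - 1) \<le> c * Suc i"
      by (intro mult_le_mono2) simp
    then have "c * Suc (i - 1) \<le> n" using n by linarith
    then show "(if i = 0 then of_bool b else f (i - 1) (wval (prefix_of z n)))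
        = of_bool (ccons b (F z) i)"
      using fF by (auto simp: ccons_def)
  qed
qed

lemma lin_computable_if_bit:
  assumes "lin_computable F" "lin_computable G"
  shows "lin_computable (\<lambda>z. if z k then F z else G z)"
proof -
  obtain f c where f: "comp_fn 2 (\<lambda>xs. f (xs ! 0) (xs ! 1))"
    and fF: "\<And>z i n. c * Suc i \<le> n \<Longrightarrow> f i (wval (prefix_of z n)) = of_bool (F z i)"
    using assms(1) unfolding lin_computable_def by metis
  obtain g d where g: "comp_fn 2 (\<lambda>xs. g (xs ! 0) (xs ! 1))"
    and gG: "\<And>z i n. d * Suc i \<le> n \<Longrightarrow> g i (wval (prefix_of z n)) = of_bool (G z i)"
    using assms(2) unfolding lin_computable_def by metis
  show ?thesis
    unfolding lin_computable_def
  proof (intro exI conjI allI impI)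
    show "comp_fn 2 (\<lambda>xs. if xs ! 1 div 2 ^ k mod 2 = 0 then g (xs ! 0) (xs ! 1)
        else f (xs ! 0) (xs ! 1))"
      by (intro comp_fn_if_zero comp_fn_mod2 comp_fn_subst2[OF f] comp_fn_subst2[OF g]
          comp_fn_div comp_fn_const comp_fn_nth) auto
    \<comment> \<open>The summand \<open>Suc k\<close> keeps the tested bit inside the prefix for
      every output position.\<close>
    fix z i n assume n: "(c + d + Suc k) * Suc i \<le> n"
    then have "c * Suc i \<le> n" "d * Suc i \<le> n" "k < n"
      by (auto simp: algebra_simps)
    then show "(if wval (prefix_of z n) div 2 ^ k mod 2 = 0 then g i (wval (prefix_of z n))
        else f i (wval (prefix_of z n))) = of_bool ((if z k then F z else G z) i)"
      using fF gG wval_bit[of k "prefix_of z n"] by (auto simp: prefix_of_def)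
  qed
qed

text \<open>Apply the computable \<open>H\<close> that reduces the identity to \<open>f\<close> to
  the zero sequence. Its prefixes have codes \<open>2 ^ m - 1\<close>, so each bit of
  \<open>H o0\<close> can be found by searching for a prefix that makes the word function emit
  it.\<close>

lemma pointed_imp_computable_point:
  assumes "pointed f"
  shows "\<exists>p\<in>mdom f. comp_fn 1 (\<lambda>xs. of_bool (p (xs ! 0)))"
proof -
  obtain H where H: "computable_on (mdom idW) H" and dom: "\<forall>x\<in>mdom idW. H x \<in> mdom f"
    using assms unfolding pointed_def W_le_def by blast
  define o0 :: cantor where "o0 = (\<lambda>_. False)"
  have o0: "o0 \<in> mdom idW" by (simp add: mdom_def idW_def)
  obtain \<phi> where \<phi>: "computable_word \<phi>"
    and val: "\<And>m i. i < length (\<phi> (prefix_of o0 m)) \<Longrightarrow> \<phi> (prefix_of o0 m) ! i = H o0 i"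
    and len: "\<And>n. \<exists>m. n \<le> length (\<phi> (prefix_of o0 m))"
    using H o0 unfolding computable_on_def by metis
  obtain h where "computable_nat h" and h: "\<And>w. h (wcode w) = wcode (\<phi> w)"
    using \<phi> unfolding computable_word_def by blast
  then have hc: "comp_fn 1 (\<lambda>xs. h (xs ! 0))" by (simp add: computable_nat_iff_comp_fn)
  have prefix_o0: "prefix_of o0 m = replicate m False" for m
    by (auto simp: prefix_of_def o0_def intro: nth_equalityI)
  have h_val: "Suc (h (2 ^ m - 1)) = wval (\<phi> (prefix_of o0 m))" for m
  proof -
    have "wcode (replicate m False) = 2 ^ m - 1"
      using wval_replicate_False[of m] by (simp add: wval_def)
    then show ?thesis using h[of "replicate m False"] by (simp add: prefix_o0 wval_def)
  qed
  \<comment> \<open>A word of value at least \<open>2 ^ (n + 1)\<close> has more than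
    \<open>n\<close> bits, so the prefix of length \<open>M n\<close> produces output bit
    \<open>n\<close>.\<close>
  define M where "M n = (LEAST m. 2 ^ Suc n - Suc (h (2 ^ m - 1)) = 0)" for n
  have ex: "\<exists>m. 2 ^ Suc n - Suc (h (2 ^ m - 1)) = 0" for n
  proof -
    obtain m where "Suc n \<le> length (\<phi> (prefix_of o0 m))" using len by blast
    then have "(2::nat) ^ Suc n \<le> 2 ^ length (\<phi> (prefix_of o0 m))" by (rule power_increasing) simp
    also have "\<dots> \<le> wval (\<phi> (prefix_of o0 m))" by (rule wval_bounds)
    finally show ?thesis unfolding h_val by (intro exI[of _ m]) simp
  qed
  have "comp_fn 1 (\<lambda>xs. LEAST m. 2 ^ Suc ((m # xs) ! 1) - Suc (h (2 ^ (m # xs) ! 0 - 1)) = 0)"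
    using ex by (intro comp_fn_Least comp_fn_diff comp_fn_power2 comp_fn_Suc comp_fn_nth
        comp_fn_subst1[OF hc] comp_fn_pred) auto
  then have M: "comp_fn 1 (\<lambda>xs. M (xs ! 0))" by (simp add: M_def)
  have "comp_fn 1 (\<lambda>xs. Suc (h (2 ^ M (xs ! 0) - 1)) div 2 ^ (xs ! 0) mod 2)"
    by (intro comp_fn_mod2 comp_fn_div comp_fn_power2 comp_fn_Suc comp_fn_nth M
        comp_fn_subst1[OF hc] comp_fn_pred) auto
  moreover have "Suc (h (2 ^ M n - 1)) div 2 ^ n mod 2 = of_bool (H o0 n)" for n
  proof -
    have "(2::nat) ^ Suc n \<le> wval (\<phi> (prefix_of o0 (M n)))"
    proof -
      have "2 ^ Suc n - Suc (h (2 ^ M n - 1)) = 0"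
        unfolding M_def by (rule LeastI_ex[OF ex])
      then show ?thesis unfolding h_val by simp
    qed
    also have "\<dots> < 2 ^ Suc (length (\<phi> (prefix_of o0 (M n))))" by (rule wval_bounds)
    finally have "n < length (\<phi> (prefix_of o0 (M n)))"
      by (simp only: power_strict_increasing_iff one_less_numeral_iff semiring_norm Suc_less_eq)
    then show ?thesis unfolding h_val by (simp add: wval_bit val)
  qed
  ultimately have "comp_fn 1 (\<lambda>xs. of_bool (H o0 (xs ! 0)))" by simp
  then show ?thesis using dom o0 by blast
qed

section \<open>Countability and genericity\<close>

instance recf :: countable
  by countable_datatype

text \<open>Determinism lets a program represent at most one word function, which is the source of
  countability below.\<close>

lemma reval_deterministic: "reval r xs y \<Longrightarrow> reval r xs z \<Longrightarrow> y = z"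
proof (induction arbitrary: z rule: reval.induct)
  case (1 xs)
  then show ?case by (rule reval.cases) auto
next
  case (2 x xs)
  then show ?case by (rule reval.cases) auto
next
  case (3 i xs)
  from 3(2) show ?case by (rule reval.cases) auto
next
  case (5 f xs y g)
  from 5(3) have "reval f xs z" by (rule reval.cases) auto
  then show ?case by (rule 5(2))
next
  case (4 xs gs ys f y)
  from 4(4) obtain ys' where ys': "list_all2 (\<lambda>g y. reval g xs y) gs ys'" "reval f ys' z"
    by (rule reval.cases) auto
  have "ys = ys'"
    using 4(1) ys'(1) by (intro nth_equalityI) (auto simp: list_all2_conv_all_nth)
  then show ?case using 4 ys' by blast
next
  case (6 f g n xs r y)
  from 6(5) obtain r' where "reval (PrimRec f g) (n # xs) r'" "reval g (r' # n # xs) z"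
    by (rule reval.cases) auto
  then show ?case using 6 by blast
next
  case (7 f y xs)
  from 7(4) have z: "reval f (z # xs) 0 \<and> (\<forall>i<z. \<exists>v. v \<noteq> 0 \<and> reval f (i # xs) v)"
    by (rule reval.cases) auto
  show ?case
  proof (rule linorder_cases[of y z])
    assume "y < z"
    then show ?thesis using z 7(2) by blast
  next
    assume "z < y"
    then show ?thesis using z 7(3) by blast
  qed
qed

text \<open>Programs are countable, and each word function is recovered from a program for it, by
  determinism and injectivity of \<open>wcode\<close>.\<close>

lemma countable_computable_word: "countable {\<phi>. computable_word \<phi>}"
proof (rule countable_subset)
  show "{\<phi>. computable_word \<phi>}
      \<subseteq> range (\<lambda>r::recf. THE \<phi>. \<forall>w. reval r [wcode w] (wcode (\<phi> w)))"
  proof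
    fix \<phi> assume "\<phi> \<in> {\<phi>. computable_word \<phi>}"
    then obtain h r where "\<forall>n. reval r [n] (h n)" "\<forall>w. h (wcode w) = wcode (\<phi> w)"
      unfolding computable_word_def computable_nat_def by blast
    then have r: "\<forall>w. reval r [wcode w] (wcode (\<phi> w))" by metis
    have "(THE \<phi>. \<forall>w. reval r [wcode w] (wcode (\<phi> w))) = \<phi>"
    proof (rule the_equality)
      show "\<forall>w. reval r [wcode w] (wcode (\<phi> w))" by (fact r)
      show "\<psi> = \<phi>" if "\<forall>w. reval r [wcode w] (wcode (\<psi> w))" for \<psi>
        using that r reval_deterministic injD[OF inj_wcode] by (intro ext) blast
    qed
    then show "\<phi> \<in> range (\<lambda>r::recf. THE \<phi>. \<forall>w. reval r [wcode w] (wcode (\<phi> w)))" by blast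
  qed
qed simp

section \<open>Generic points by finite extension\<close>

definition extends :: "('a \<Rightarrow> bool) \<Rightarrow> ('a \<rightharpoonup> bool) \<Rightarrow> bool" where
  "extends Q \<sigma> \<longleftrightarrow> (\<forall>x b. \<sigma> x = Some b \<longrightarrow> Q x = b)"

text \<open>A Baire category argument: enumerate the sets in \<open>R\<close> and extend a finite
  condition step by step, each step securing that one more set is avoided.\<close>

lemma generic_exists:
  assumes "countable R"
    and dense: "\<And>S \<sigma>. S \<in> R \<Longrightarrow> finite (dom \<sigma>) \<Longrightarrow>
      \<exists>\<tau>. finite (dom \<tau>) \<and> \<sigma> \<subseteq>\<^sub>m \<tau> \<and> (\<forall>Q. extends Q \<tau> \<longrightarrow> Q \<notin> S)"
  shows "\<exists>Q. Q \<notin> \<Union>R"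
proof (cases "R = {}")
  case False
  define step where "step S \<sigma> = (SOME \<tau>. finite (dom \<tau>) \<and> \<sigma> \<subseteq>\<^sub>m \<tau> \<and> (\<forall>Q. extends Q \<tau> \<longrightarrow> Q \<notin> S))"
    for S and \<sigma> :: "'a \<rightharpoonup> bool"
  have step_fin: "finite (dom (step S \<sigma>))" and step_ext: "\<sigma> \<subseteq>\<^sub>m step S \<sigma>"
    and step_avoid: "\<And>Q. extends Q (step S \<sigma>) \<Longrightarrow> Q \<notin> S"
    if "S \<in> R" "finite (dom \<sigma>)" for S \<sigma>
    using someI_ex[OF dense[OF that]] unfolding step_def by blast+
  \<comment> \<open>The condition at stage \<open>k + 1\<close> avoids the \<open>k\<close>-th set
    of the enumeration.\<close>
  define ch where "ch = rec_nat Map.empty (\<lambda>k. step (from_nat_into R k))"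
  have ch_Suc: "ch (Suc k) = step (from_nat_into R k) (ch k)" for k by (simp add: ch_def)
  have inR: "from_nat_into R k \<in> R" for k using False by (rule from_nat_into)
  have fin: "finite (dom (ch k))" for k
  proof (induction k)
    case 0
    then show ?case by (simp add: ch_def)
  next
    case (Suc k)
    then show ?case unfolding ch_Suc by (rule step_fin[OF inR])
  qed
  have mono: "ch j \<subseteq>\<^sub>m ch k" if "j \<le> k" for j k
    using that
  proof (induction rule: dec_induct)
    case (step n)
    have "ch n \<subseteq>\<^sub>m ch (Suc n)" unfolding ch_Suc by (rule step_ext[OF inR fin])
    with step show ?case using map_le_trans by blast
  qed simp
  \<comment> \<open>Positions that no condition decides get the value \<open>False\<close>; the
    others are consistent because the conditions form a chain.\<close>
  define Q where "Q x = (\<exists>k. ch k x = Some True)" for x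
  have "extends Q (ch k)" for k
    unfolding extends_def
  proof (intro allI impI)
    fix x b assume k: "ch k x = Some b"
    have "b = c" if "ch j x = Some c" for j c
      using mono[of j k] mono[of k j] k that nat_le_linear[of j k]
      by (metis domI map_le_def option.inject)
    with k show "Q x = b" unfolding Q_def by (metis (full_types))
  qed
  then have "Q \<notin> from_nat_into R k" for k
    by (metis ch_Suc fin inR step_avoid)
  then have "Q \<notin> \<Union>R"
    using from_nat_into_surj[OF assms(1)] by (metis UnionE)
  then show ?thesis by blast
qed simp

section \<open>Maximal cliques of term graphs\<close>

lemma edges_gplus:
  "{False # a, False # b} \<in> edges (gplus G H) \<longleftrightarrow> {a, b} \<in> edges G"
  "{True # a, True # b} \<in> edges (gplus G H) \<longleftrightarrow> {a, b} \<in> edges H"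
  "{False # a, True # b} \<notin> edges (gplus G H)"
  "{True # a, False # b} \<notin> edges (gplus G H)"
proof -
  have img: "{x # a, x # b} \<in> image (Cons x) ` E \<longleftrightarrow> {a, b} \<in> E" for x :: bool and a b E
  proof -
    have "{x # a, x # b} = Cons x ` {a, b}" by simp
    then show ?thesis
      using inj_image_mem_iff[of "image (Cons x)" "{a, b}" E] by (simp add: inj_on_def inj_image_eq_iff)
  qed
  have no: "S \<notin> image (Cons y) ` E" if "x # a \<in> S" "x \<noteq> y" for x y :: bool and a S E
  proof
    assume "S \<in> image (Cons y) ` E"
    then obtain e where "S = Cons y ` e" by blast
    with that show False by blast
  qed
  show "{False # a, False # b} \<in> edges (gplus G H) \<longleftrightarrow> {a, b} \<in> edges G"
    "{True # a, True # b} \<in> edges (gplus G H) \<longleftrightarrow> {a, b} \<in> edges H"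
    "{False # a, True # b} \<notin> edges (gplus G H)"
    "{True # a, False # b} \<notin> edges (gplus G H)"
    using no[of True b "{False # a, True # b}" False] no[of False a "{False # a, True # b}" True]
      no[of False b "{True # a, False # b}" True] no[of True a "{True # a, False # b}" False]
      no[of False a "{False # a, False # b}" True] no[of True a "{True # a, True # b}" False]
    by (simp_all add: gplus_def img)
qed

lemma edges_gcompl:
  "{a, b} \<in> edges (gcompl G) \<longleftrightarrow> a \<in> verts G \<and> b \<in> verts G \<and> a \<noteq> b \<and> {a, b} \<notin> edges G"
  by (auto simp: gcompl_def pairs2_def card_2_iff doubleton_eq_iff)

lemma verts_gplus: "verts (gplus G H) = Cons False ` verts G \<union> Cons True ` verts H"
  by (simp add: gplus_def)

lemma verts_gcompl [simp]: "verts (gcompl G) = verts G"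
  by (simp add: gcompl_def)

lemma verts_tgraph [simp]:
  "verts (tgraph (Var x)) = {[]}"
  "verts (tgraph (Meet t u)) = Cons False ` verts (tgraph t) \<union> Cons True ` verts (tgraph u)"
  "verts (tgraph (Times t u)) = Cons False ` verts (tgraph t) \<union> Cons True ` verts (tgraph u)"
  by (simp_all add: verts_gplus)

lemma col_tgraph [simp]:
  "col (tgraph (Var x)) v = x"
  "col (tgraph (Meet t u)) (False # v) = col (tgraph t) v"
  "col (tgraph (Meet t u)) (True # v) = col (tgraph u) v"
  "col (tgraph (Times t u)) (False # v) = col (tgraph t) v"
  "col (tgraph (Times t u)) (True # v) = col (tgraph u) v"
  by (simp_all add: gplus_def gcompl_def)

declare tgraph.simps [simp del]

lemma verts_tgraph_nonempty: "verts (tgraph t) \<noteq> {}"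
  by (induction t) auto

section \<open>Cliques of disjoint unions and joins\<close>

lemma is_clique_Meet:
  "is_clique (tgraph (Meet t u)) C \<longleftrightarrow>
    (\<exists>A. is_clique (tgraph t) A \<and> C = Cons False ` A) \<or>
    (\<exists>B. is_clique (tgraph u) B \<and> C = Cons True ` B)" (is "?L \<longleftrightarrow> ?R")
proof
  assume L: ?L
  have sub: "C \<subseteq> Cons False ` verts (tgraph t) \<union> Cons True ` verts (tgraph u)"
    and e: "\<And>a b. a \<in> C \<Longrightarrow> b \<in> C \<Longrightarrow> a \<noteq> b \<Longrightarrow> {a, b} \<in> edges (gplus (tgraph t) (tgraph u))"
    using L unfolding is_clique_def by (simp_all add: tgraph.simps verts_gplus)
  define A where "A = {a. False # a \<in> C}"
  define B where "B = {a. True # a \<in> C}"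
  have C: "C = Cons False ` A \<union> Cons True ` B" using sub by (auto simp: A_def B_def)
  have "{a, b} \<in> edges (tgraph t)" if "a \<in> A" "b \<in> A" "a \<noteq> b" for a b
    using e[of "False # a" "False # b"] that by (simp add: A_def edges_gplus)
  moreover have "{a, b} \<in> edges (tgraph u)" if "a \<in> B" "b \<in> B" "a \<noteq> b" for a b
    using e[of "True # a" "True # b"] that by (simp add: B_def edges_gplus)
  moreover have "A \<subseteq> verts (tgraph t)" "B \<subseteq> verts (tgraph u)"
    using sub by (auto simp: A_def B_def)
  ultimately have "is_clique (tgraph t) A" "is_clique (tgraph u) B"
    by (auto simp: is_clique_def)
  moreover have "A = {} \<or> B = {}"
    using e edges_gplus(3) unfolding A_def B_def by blast
  ultimately show ?R using C by (metis image_empty sup_bot.left_neutral sup_bot.right_neutral)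
next
  assume ?R
  then show ?L
  proof (elim disjE exE conjE)
    fix A assume "is_clique (tgraph t) A" and C: "C = Cons False ` A"
    then show ?L
      unfolding is_clique_def C tgraph.simps verts_gplus by (simp add: edges_gplus image_subset_iff) blast
  next
    fix A assume "is_clique (tgraph u) A" and C: "C = Cons True ` A"
    then show ?L
      unfolding is_clique_def C tgraph.simps verts_gplus by (simp add: edges_gplus image_subset_iff) blast
  qed
qed

text \<open>Complementing, adding and complementing again joins every vertex of the left graph to
  every vertex of the right one, so cliques of the two sides combine freely.\<close>

lemma is_clique_Times:
  "is_clique (tgraph (Times t u)) C \<longleftrightarrow>
    (\<exists>A B. is_clique (tgraph t) A \<and> is_clique (tgraph u) B \<and> C = Cons False ` A \<union> Cons True ` B)"
  (is "?L \<longleftrightarrow> ?R")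
proof
  assume L: ?L
  have sub: "C \<subseteq> Cons False ` verts (tgraph t) \<union> Cons True ` verts (tgraph u)"
    and e: "\<And>a b. a \<in> C \<Longrightarrow> b \<in> C \<Longrightarrow> a \<noteq> b \<Longrightarrow> {a, b} \<in> edges (tgraph (Times t u))"
    using L unfolding is_clique_def by simp_all
  define A where "A = {a. False # a \<in> C}"
  define B where "B = {a. True # a \<in> C}"
  have C: "C = Cons False ` A \<union> Cons True ` B" using sub by (auto simp: A_def B_def)
  have "{a, b} \<in> edges (tgraph t)" if "a \<in> A" "b \<in> A" "a \<noteq> b" for a b
    using e[of "False # a" "False # b"] that sub
    by (auto simp: A_def tgraph.simps edges_gcompl edges_gplus)
  moreover have "{a, b} \<in> edges (tgraph u)" if "a \<in> B" "b \<in> B" "a \<noteq> b" for a b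
    using e[of "True # a" "True # b"] that sub
    by (auto simp: B_def tgraph.simps edges_gcompl edges_gplus)
  moreover have "A \<subseteq> verts (tgraph t)" "B \<subseteq> verts (tgraph u)"
    using sub by (auto simp: A_def B_def)
  ultimately have "is_clique (tgraph t) A" "is_clique (tgraph u) B"
    by (auto simp: is_clique_def)
  with C show ?R by blast
next
  assume ?R
  then obtain A B where cl: "is_clique (tgraph t) A" "is_clique (tgraph u) B"
    and C: "C = Cons False ` A \<union> Cons True ` B"
    by blast
  have sub: "A \<subseteq> verts (tgraph t)" "B \<subseteq> verts (tgraph u)"
    and e: "\<And>a b. a \<in> A \<Longrightarrow> b \<in> A \<Longrightarrow> a \<noteq> b \<Longrightarrow> {a, b} \<in> edges (tgraph t)"
      "\<And>a b. a \<in> B \<Longrightarrow> b \<in> B \<Longrightarrow> a \<noteq> b \<Longrightarrow> {a, b} \<in> edges (tgraph u)"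
    using cl by (simp_all add: is_clique_def)
  show ?L
    unfolding is_clique_def
  proof (intro conjI ballI impI)
    show "C \<subseteq> verts (tgraph (Times t u))" unfolding C using sub by auto
    fix v w assume "v \<in> C" "w \<in> C" and ne: "v \<noteq> w"
    then consider a b where "v = False # a" "w = False # b" "a \<in> A" "b \<in> A"
      | a b where "v = False # a" "w = True # b" "a \<in> A" "b \<in> B"
      | a b where "v = True # a" "w = False # b" "a \<in> B" "b \<in> A"
      | a b where "v = True # a" "w = True # b" "a \<in> B" "b \<in> B"
      unfolding C by blast
    then show "{v, w} \<in> edges (tgraph (Times t u))"
      using ne sub e
      by cases (simp_all add: tgraph.simps edges_gcompl edges_gplus verts_gplus subset_iff)
  qed
qed

lemma max_clique_nonempty: "max_clique (tgraph t) C \<Longrightarrow> C \<noteq> {}"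
proof
  assume "max_clique (tgraph t) C" "C = {}"
  moreover obtain v where "v \<in> verts (tgraph t)" using verts_tgraph_nonempty by blast
  then have "is_clique (tgraph t) {v}" by (simp add: is_clique_def)
  ultimately show False unfolding max_clique_def by blast
qed

lemma Cons_image_subset_iff: "Cons x ` A \<subseteq> Cons y ` B \<longleftrightarrow> A \<subseteq> B \<and> (A = {} \<or> x = y)"
  by auto

lemma Cons_image_eq_iff: "Cons x ` A = Cons y ` B \<longleftrightarrow> A = B \<and> (A = {} \<or> x = y)"
  unfolding set_eq_subset Cons_image_subset_iff by blast

lemma max_clique_Meet:
  "max_clique (tgraph (Meet t u)) C \<longleftrightarrow>
    (\<exists>A. max_clique (tgraph t) A \<and> C = Cons False ` A) \<or>
    (\<exists>B. max_clique (tgraph u) B \<and> C = Cons True ` B)" (is "?L \<longleftrightarrow> ?R")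
proof
  assume L: ?L
  then have "is_clique (tgraph (Meet t u)) C" and
    m: "\<And>C'. is_clique (tgraph (Meet t u)) C' \<Longrightarrow> C \<subseteq> C' \<Longrightarrow> C' = C"
    unfolding max_clique_def by blast+
  then consider A where "is_clique (tgraph t) A" "C = Cons False ` A"
    | B where "is_clique (tgraph u) B" "C = Cons True ` B"
    unfolding is_clique_Meet by blast
  then show ?R
  proof cases
    case 1
    have "A' = A" if "is_clique (tgraph t) A'" "A \<subseteq> A'" for A'
      using m[of "Cons False ` A'"] that 1 unfolding is_clique_Meet
      by (auto simp: Cons_image_eq_iff)
    then show ?thesis using 1 unfolding max_clique_def by blast
  next
    case 2
    have "B' = B" if "is_clique (tgraph u) B'" "B \<subseteq> B'" for B'
      using m[of "Cons True ` B'"] that 2 unfolding is_clique_Meet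
      by (auto simp: Cons_image_eq_iff)
    then show ?thesis using 2 unfolding max_clique_def by blast
  qed
next
  assume ?R
  then show ?L
  proof (elim disjE exE conjE)
    fix A assume A: "max_clique (tgraph t) A" "C = Cons False ` A"
    have "C' = C" if C': "is_clique (tgraph (Meet t u)) C'" "C \<subseteq> C'" for C'
    proof -
      \<comment> \<open>A maximal clique is nonempty, so a clique containing it must lie on the same
        side of the disjoint union.\<close>
      have "\<not> C \<subseteq> Cons True ` B" for B
        using max_clique_nonempty[OF A(1)] unfolding A(2) Cons_image_subset_iff by simp
      then obtain A' where A': "is_clique (tgraph t) A'" "C' = Cons False ` A'"
        using C' unfolding is_clique_Meet by blast
      then have "A \<subseteq> A'" using C'(2) unfolding A(2) A'(2) Cons_image_subset_iff by blast
      then show ?thesis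
        using A A' unfolding max_clique_def by blast
    qed
    moreover have "is_clique (tgraph (Meet t u)) C"
      using A unfolding max_clique_def is_clique_Meet by blast
    ultimately show ?L unfolding max_clique_def by blast
  next
    fix A assume A: "max_clique (tgraph u) A" "C = Cons True ` A"
    have "C' = C" if C': "is_clique (tgraph (Meet t u)) C'" "C \<subseteq> C'" for C'
    proof -
      have "\<not> C \<subseteq> Cons False ` B" for B
        using max_clique_nonempty[OF A(1)] unfolding A(2) Cons_image_subset_iff by simp
      then obtain A' where A': "is_clique (tgraph u) A'" "C' = Cons True ` A'"
        using C' unfolding is_clique_Meet by blast
      then have "A \<subseteq> A'" using C'(2) unfolding A(2) A'(2) Cons_image_subset_iff by blast
      then show ?thesis
        using A A' unfolding max_clique_def by blast
    qed
    moreover have "is_clique (tgraph (Meet t u)) C"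
      using A unfolding max_clique_def is_clique_Meet by blast
    ultimately show ?L unfolding max_clique_def by blast
  qed
qed

lemma Cons_union_subset_iff:
  "Cons False ` A \<union> Cons True ` B \<subseteq> Cons False ` A' \<union> Cons True ` B' \<longleftrightarrow> A \<subseteq> A' \<and> B \<subseteq> B'"
  by auto

lemma Cons_union_eq_iff:
  "Cons False ` A \<union> Cons True ` B = Cons False ` A' \<union> Cons True ` B' \<longleftrightarrow> A = A' \<and> B = B'"
  unfolding set_eq_subset Cons_union_subset_iff by blast

lemma max_clique_Times:
  "max_clique (tgraph (Times t u)) C \<longleftrightarrow>
    (\<exists>A B. max_clique (tgraph t) A \<and> max_clique (tgraph u) B \<and> C = Cons False ` A \<union> Cons True ` B)"
  (is "?L \<longleftrightarrow> ?R")
proof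
  assume L: ?L
  then have "is_clique (tgraph (Times t u)) C" by (simp add: max_clique_def)
  then obtain A B where C: "C = Cons False ` A \<union> Cons True ` B"
    and cl: "is_clique (tgraph t) A" "is_clique (tgraph u) B"
    unfolding is_clique_Times by blast
  have m: "A' = A \<and> B' = B"
    if "is_clique (tgraph t) A'" "is_clique (tgraph u) B'" "A \<subseteq> A'" "B \<subseteq> B'" for A' B'
  proof -
    have "is_clique (tgraph (Times t u)) (Cons False ` A' \<union> Cons True ` B')"
      unfolding is_clique_Times using that by blast
    moreover have "C \<subseteq> Cons False ` A' \<union> Cons True ` B'"
      unfolding C Cons_union_subset_iff using that by blast
    ultimately have "Cons False ` A' \<union> Cons True ` B' = C"
      using L unfolding max_clique_def by blast
    then show ?thesis unfolding C Cons_union_eq_iff .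
  qed
  then show ?R using C cl unfolding max_clique_def by blast
next
  assume ?R
  then obtain A B where AB: "max_clique (tgraph t) A" "max_clique (tgraph u) B"
    and C: "C = Cons False ` A \<union> Cons True ` B" by blast
  have "C' = C" if C': "is_clique (tgraph (Times t u)) C'" "C \<subseteq> C'" for C'
  proof -
    obtain A' B' where *: "is_clique (tgraph t) A'" "is_clique (tgraph u) B'"
      "C' = Cons False ` A' \<union> Cons True ` B'"
      using C'(1) unfolding is_clique_Times by blast
    then have "A \<subseteq> A'" "B \<subseteq> B'"
      using C'(2) unfolding C *(3) Cons_union_subset_iff by blast+
    then have "A' = A" "B' = B" using AB * unfolding max_clique_def by blast+
    then show ?thesis unfolding C *(3) by simp
  qed
  moreover have "is_clique (tgraph (Times t u)) C"
    using AB C unfolding max_clique_def is_clique_Times by blast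
  ultimately show ?L unfolding max_clique_def by blast
qed

text \<open>The shape of a solution: \<open>Tag\<close> records the choice made at a meet, \<open>Node\<close> the two parts of
  a product, and the leaves name the vertices of the chosen maximal clique.\<close>
datatype 'l resp = Leaf 'l | Tag bool "'l resp" | Node "'l resp" "'l resp"

instance resp :: (countable) countable
  by countable_datatype

primrec den :: "('l \<Rightarrow> cantor) \<Rightarrow> 'l resp \<Rightarrow> cantor" where
  "den s (Leaf l) = s l"
| "den s (Tag b a) = ccons b (den s a)"
| "den s (Node a b) = cpair (den s a) (den s b)"

lemma den_map_resp: "den s (map_resp f a) = den (s \<circ> f) a"
  by (induction a) auto

lemma den_cong: "(\<And>v. v \<in> set_resp a \<Longrightarrow> s v = s' v) \<Longrightarrow> den s a = den s' a"
  by (induction a) auto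

fun answers :: "'v trm \<Rightarrow> bool list resp set" where
  "answers (Var x) = {Leaf []}"
| "answers (Meet t u) = (\<lambda>a. Tag False (map_resp (Cons False) a)) ` answers t
     \<union> (\<lambda>a. Tag True (map_resp (Cons True) a)) ` answers u"
| "answers (Times t u) = (\<lambda>(a, b). Node (map_resp (Cons False) a) (map_resp (Cons True) b))
     ` (answers t \<times> answers u)"

text \<open>Maximal cliques and answers obey the same recursion: a meet takes one from either side,
  a product takes one from each side.\<close>

lemma max_clique_iff_answer:
  "max_clique (tgraph t) C \<longleftrightarrow> C \<in> set_resp ` answers t"
proof (induction t arbitrary: C)
  case (Var x)
  have "is_clique (tgraph (Var x)) D \<longleftrightarrow> D = {} \<or> D = {[]}" for D
    by (auto simp: is_clique_def tgraph.simps)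
  then show ?case by (auto simp: max_clique_def)
next
  case (Meet t u)
  have "C \<in> set_resp ` answers (Meet t u) \<longleftrightarrow>
      (\<exists>a\<in>answers t. C = Cons False ` set_resp a) \<or> (\<exists>a\<in>answers u. C = Cons True ` set_resp a)"
    by (simp add: image_Un image_image resp.set_map) blast
  then show ?case by (auto simp: max_clique_Meet Meet.IH image_iff simp del: answers.simps)
next
  case (Times t u)
  have "C \<in> set_resp ` answers (Times t u) \<longleftrightarrow>
      (\<exists>a\<in>answers t. \<exists>b\<in>answers u. C = Cons False ` set_resp a \<union> Cons True ` set_resp b)"
  proof
    assume "C \<in> set_resp ` answers (Times t u)"
    then obtain a b where "a \<in> answers t" "b \<in> answers u"
      "C = set_resp (Node (map_resp (Cons False) a) (map_resp (Cons True) b))" by auto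
    then show "\<exists>a\<in>answers t. \<exists>b\<in>answers u. C = Cons False ` set_resp a \<union> Cons True ` set_resp b"
      unfolding resp.set resp.set_map by blast
  next
    assume "\<exists>a\<in>answers t. \<exists>b\<in>answers u. C = Cons False ` set_resp a \<union> Cons True ` set_resp b"
    then obtain a b where "a \<in> answers t" "b \<in> answers u"
      "C = set_resp (Node (map_resp (Cons False) a) (map_resp (Cons True) b))"
      unfolding resp.set resp.set_map by blast
    moreover from this have "Node (map_resp (Cons False) a) (map_resp (Cons True) b) \<in> answers (Times t u)"
      by auto
    ultimately show "C \<in> set_resp ` answers (Times t u)" by blast
  qed
  then show ?case by (auto simp: max_clique_Times Times.IH image_iff simp del: answers.simps)
qed

lemma set_resp_answers: "a \<in> answers t \<Longrightarrow> set_resp a \<subseteq> verts (tgraph t)"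
  using max_clique_iff_answer[of t "set_resp a"] by (auto simp: max_clique_def is_clique_def)

section \<open>Evaluation of terms\<close>

lemma cantor_pair_simps [simp]:
  "cfst (cpair p q) = p" "csnd (cpair p q) = q"
  "ccons b p 0 = b" "ccons b p (Suc n) = p n"
  by (auto simp: cfst_def csnd_def cpair_def ccons_def)

lemma cpair_index [simp]: "cpair p q (2 * n) = p n" "cpair p q (Suc (2 * n)) = q n"
  by (auto simp: cpair_def)

text \<open>A tag shifts positions by one and a pairing doubles them, so a leaf is spread over an
  arithmetic progression that depends only on the shape. This is what makes copying it
  computable.\<close>

lemma leaf_position:
  "v \<in> set_resp a \<Longrightarrow> \<exists>A B. \<forall>s n. den s a (A * n + B) = s v n"
proof (induction a)
  case (Leaf l)
  then show ?case by (intro exI[of _ 1] exI[of _ 0]) simp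
next
  case (Tag b a)
  then obtain A B where "\<forall>s n. den s a (A * n + B) = s v n" by auto
  then show ?case by (intro exI[of _ A] exI[of _ "Suc B"]) simp
next
  case (Node a b)
  then consider "v \<in> set_resp a" | "v \<in> set_resp b" by auto
  then show ?case
  proof cases
    case 1
    then obtain A B where "\<forall>s n. den s a (A * n + B) = s v n" using Node.IH by blast
    moreover have "2 * A * n + 2 * B = 2 * (A * n + B)" for n by simp
    ultimately show ?thesis by (intro exI[of _ "2 * A"] exI[of _ "2 * B"]) (simp only: den.simps cpair_index, simp)
  next
    case 2
    then obtain A B where "\<forall>s n. den s b (A * n + B) = s v n" using Node.IH by blast
    moreover have "2 * A * n + Suc (2 * B) = Suc (2 * (A * n + B))" for n by simp
    ultimately show ?thesis by (intro exI[of _ "2 * A"] exI[of _ "Suc (2 * B)"]) (simp only: den.simps cpair_index, simp)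
  qed
qed

text \<open>A single bit of a solution is either a tag or one bit of one leaf; the genericity
  argument uses this to bound which leaves a finite prefix can see.\<close>

lemma den_bit_dependence:
  "(\<exists>b. \<forall>s. den s a i = b) \<or> (\<exists>v\<in>set_resp a. \<exists>j. \<forall>s. den s a i = s v j)"
proof (induction a arbitrary: i)
  case (Leaf l)
  then show ?case by auto
next
  case (Tag b a)
  then show ?case by (cases i) auto
next
  case (Node a b)
  show ?case
  proof (cases "even i")
    case True
    then show ?thesis using Node(1)[of "i div 2"] by (auto simp: cpair_def)
  next
    case False
    then show ?thesis using Node(2)[of "i div 2"] by (auto simp: cpair_def)
  qed
qed

text \<open>Meets and products take the same inputs, namely pairs, so an instance of a term is a
  tree of pairs with one leaf per vertex; the operations differ only in their answers.\<close>

fun component :: "'v trm \<Rightarrow> cantor \<Rightarrow> bool list \<Rightarrow> cantor" where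
  "component (Var x) z v = z"
| "component (Meet t u) z v = (if hd v then component u (csnd z) (tl v) else component t (cfst z) (tl v))"
| "component (Times t u) z v = (if hd v then component u (csnd z) (tl v) else component t (cfst z) (tl v))"

fun assemble :: "'v trm \<Rightarrow> (bool list \<Rightarrow> cantor) \<Rightarrow> cantor" where
  "assemble (Var x) g = g []"
| "assemble (Meet t u) g = cpair (assemble t (g \<circ> Cons False)) (assemble u (g \<circ> Cons True))"
| "assemble (Times t u) g = cpair (assemble t (g \<circ> Cons False)) (assemble u (g \<circ> Cons True))"

lemma component_assemble: "v \<in> verts (tgraph t) \<Longrightarrow> component t (assemble t g) v = g v"
  by (induction t arbitrary: v g) auto

lemma affine_cfst:
  assumes "\<exists>A B. \<forall>z n. F z n = z (A * n + B)"
  shows "\<exists>A B. \<forall>z n. F (cfst z) n = z (A * n + B)"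
proof -
  obtain A B where "\<And>z n. F z n = z (A * n + B)" using assms by blast
  then show ?thesis
    by (intro exI[of _ "2 * A"] exI[of _ "2 * B"]) (simp add: cfst_def algebra_simps)
qed

lemma affine_csnd:
  assumes "\<exists>A B. \<forall>z n. F z n = z (A * n + B)"
  shows "\<exists>A B. \<forall>z n. F (csnd z) n = z (A * n + B)"
proof -
  obtain A B where "\<And>z n. F z n = z (A * n + B)" using assms by blast
  then show ?thesis
    by (intro exI[of _ "2 * A"] exI[of _ "Suc (2 * B)"]) (simp add: csnd_def algebra_simps)
qed

lemma component_position: "\<exists>A B. \<forall>z n. component t z v n = z (A * n + B)"
proof (induction t arbitrary: v)
  case (Var x)
  then show ?case by (intro exI[of _ 1] exI[of _ 0]) simp
next
  case (Meet t u)
  show ?case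
    using affine_cfst[OF Meet.IH(1)[of "tl v"]] affine_csnd[OF Meet.IH(2)[of "tl v"]]
    by (cases "hd v") simp_all
next
  case (Times t u)
  show ?case
    using affine_cfst[OF Times.IH(1)[of "tl v"]] affine_csnd[OF Times.IH(2)[of "tl v"]]
    by (cases "hd v") simp_all
qed

lemma mdom_evalW:
  "z \<in> mdom (evalW \<alpha> t) \<longleftrightarrow>
    (\<forall>v\<in>verts (tgraph t). component t z v \<in> mdom (\<alpha> (col (tgraph t) v)))"
proof (induction t arbitrary: z)
  case (Meet t u)
  have "z \<in> mdom (evalW \<alpha> (Meet t u)) \<longleftrightarrow> cfst z \<in> mdom (evalW \<alpha> t) \<and> csnd z \<in> mdom (evalW \<alpha> u)"
    by (auto simp: mdom_def meetW_def)
  then show ?case unfolding Meet by (simp add: ball_Un)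
next
  case (Times t u)
  have "z \<in> mdom (evalW \<alpha> (Times t u)) \<longleftrightarrow> cfst z \<in> mdom (evalW \<alpha> t) \<and> csnd z \<in> mdom (evalW \<alpha> u)"
    by (auto simp: mdom_def timesW_def)
  then show ?case unfolding Times by (simp add: ball_Un)
qed simp

text \<open>The bridge between problems and graphs: solving a term means choosing an answer shape
  and solving, at each of its leaves, the instance at that vertex.\<close>

lemma evalW_iff_answer:
  assumes "z \<in> mdom (evalW \<alpha> t)"
  shows "y \<in> evalW \<alpha> t z \<longleftrightarrow>
    (\<exists>a\<in>answers t. \<exists>s. (\<forall>v\<in>set_resp a. s v \<in> \<alpha> (col (tgraph t) v) (component t z v)) \<and> y = den s a)"
  using assms
proof (induction t arbitrary: z y)
  case (Var x)
  show ?case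
    by (auto intro: exI[of _ "\<lambda>_. y"])
next
  case (Meet t u)
  have dom: "cfst z \<in> mdom (evalW \<alpha> t)" "csnd z \<in> mdom (evalW \<alpha> u)"
    using Meet.prems by (auto simp: mdom_def meetW_def split: if_splits)
  note IH = Meet.IH(1)[OF dom(1)] Meet.IH(2)[OF dom(2)]
  have eq: "y \<in> evalW \<alpha> (Meet t u) z \<longleftrightarrow>
      (\<exists>p. p \<in> evalW \<alpha> t (cfst z) \<and> y = ccons False p) \<or>
      (\<exists>p. p \<in> evalW \<alpha> u (csnd z) \<and> y = ccons True p)"
    using dom by (auto simp: meetW_def)
  show ?case (is "_ \<longleftrightarrow> ?R")
  proof
    assume "y \<in> evalW \<alpha> (Meet t u) z"
    then consider a s where "a \<in> answers t" "y = ccons False (den s a)"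
        "\<forall>v\<in>set_resp a. s v \<in> \<alpha> (col (tgraph t) v) (component t (cfst z) v)"
      | a s where "a \<in> answers u" "y = ccons True (den s a)"
        "\<forall>v\<in>set_resp a. s v \<in> \<alpha> (col (tgraph u) v) (component u (csnd z) v)"
      unfolding eq IH by blast
    then show ?R
    proof cases
      case 1
      \<comment> \<open>Vertices of a subterm get a head bit inside the whole term;
        \<open>s \<circ> tl\<close> removes it again.\<close>
      then show ?thesis
        by (intro bexI[of _ "Tag False (map_resp (Cons False) a)"] exI[of _ "s \<circ> tl"])
          (auto simp: resp.set_map den_map_resp comp_def)
    next
      case 2
      then show ?thesis
        by (intro bexI[of _ "Tag True (map_resp (Cons True) a)"] exI[of _ "s \<circ> tl"])
          (auto simp: resp.set_map den_map_resp comp_def)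
    qed
  next
    assume ?R
    then obtain a s where a: "a \<in> answers (Meet t u)" and y: "y = den s a"
      and s: "\<forall>v\<in>set_resp a. s v \<in> \<alpha> (col (tgraph (Meet t u)) v) (component (Meet t u) z v)"
      by blast
    from a consider a' where "a' \<in> answers t" "a = Tag False (map_resp (Cons False) a')"
      | a' where "a' \<in> answers u" "a = Tag True (map_resp (Cons True) a')"
      by auto
    then show "y \<in> evalW \<alpha> (Meet t u) z"
    proof cases
      case 1
      then have "den (s \<circ> Cons False) a' \<in> evalW \<alpha> t (cfst z)"
        unfolding IH using s by (intro bexI[of _ a'] exI[of _ "s \<circ> Cons False"]) (auto simp: resp.set_map)
      then show ?thesis unfolding eq using 1 y by (auto simp: den_map_resp)
    next
      case 2
      then have "den (s \<circ> Cons True) a' \<in> evalW \<alpha> u (csnd z)"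
        unfolding IH using s by (intro bexI[of _ a'] exI[of _ "s \<circ> Cons True"]) (auto simp: resp.set_map)
      then show ?thesis unfolding eq using 2 y by (auto simp: den_map_resp)
    qed
  qed
next
  case (Times t u)
  have dom: "cfst z \<in> mdom (evalW \<alpha> t)" "csnd z \<in> mdom (evalW \<alpha> u)"
    using Times.prems by (auto simp: mdom_def timesW_def)
  note IH = Times.IH(1)[OF dom(1)] Times.IH(2)[OF dom(2)]
  have eq: "y \<in> evalW \<alpha> (Times t u) z \<longleftrightarrow>
      (\<exists>p q. p \<in> evalW \<alpha> t (cfst z) \<and> q \<in> evalW \<alpha> u (csnd z) \<and> y = cpair p q)"
    by (auto simp: timesW_def)
  show ?case (is "_ \<longleftrightarrow> ?R")
  proof
    assume "y \<in> evalW \<alpha> (Times t u) z"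
    then obtain a s b r where *: "a \<in> answers t" "b \<in> answers u" "y = cpair (den s a) (den r b)"
        "\<forall>v\<in>set_resp a. s v \<in> \<alpha> (col (tgraph t) v) (component t (cfst z) v)"
        "\<forall>v\<in>set_resp b. r v \<in> \<alpha> (col (tgraph u) v) (component u (csnd z) v)"
      unfolding eq IH by blast
    \<comment> \<open>The head bit tells which factor a vertex comes from, so both families of
      solutions merge into one.\<close>
    define s' where "s' v = (if hd v then r (tl v) else s (tl v))" for v
    have "s' \<circ> Cons False = s" "s' \<circ> Cons True = r" by (auto simp: s'_def)
    then have "y = den s' (Node (map_resp (Cons False) a) (map_resp (Cons True) b))"
      by (simp add: den_map_resp *(3))
    moreover have "\<forall>v\<in>set_resp (Node (map_resp (Cons False) a) (map_resp (Cons True) b)).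
        s' v \<in> \<alpha> (col (tgraph (Times t u)) v) (component (Times t u) z v)"
      using *(4,5) by (simp add: resp.set_map ball_Un s'_def)
    moreover have "Node (map_resp (Cons False) a) (map_resp (Cons True) b) \<in> answers (Times t u)"
      using *(1,2) by auto
    ultimately show ?R by blast
  next
    assume ?R
    then obtain a b s where a: "a \<in> answers t" "b \<in> answers u"
      and y: "y = den s (Node (map_resp (Cons False) a) (map_resp (Cons True) b))"
      and s: "\<forall>v\<in>set_resp (Node (map_resp (Cons False) a) (map_resp (Cons True) b)).
        s v \<in> \<alpha> (col (tgraph (Times t u)) v) (component (Times t u) z v)"
      by auto
    have "den (s \<circ> Cons False) a \<in> evalW \<alpha> t (cfst z)"
      unfolding IH using s a
      by (intro bexI[of _ a] exI[of _ "s \<circ> Cons False"]) (simp_all add: resp.set_map ball_Un)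
    moreover have "den (s \<circ> Cons True) b \<in> evalW \<alpha> u (csnd z)"
      unfolding IH using s a
      by (intro bexI[of _ b] exI[of _ "s \<circ> Cons True"]) (simp_all add: resp.set_map ball_Un)
    moreover have "y = cpair (den (s \<circ> Cons False) a) (den (s \<circ> Cons True) b)"
      by (simp add: y den_map_resp)
    ultimately show "y \<in> evalW \<alpha> (Times t u) z" unfolding eq by blast
  qed
qed

section \<open>Reading the shape of an answer off a solution\<close>

fun decode :: "'v trm \<Rightarrow> cantor \<Rightarrow> bool list resp" where
  "decode (Var x) y = Leaf []"
| "decode (Meet t u) y = (if y 0 then Tag True (map_resp (Cons True) (decode u (\<lambda>i. y (Suc i))))
     else Tag False (map_resp (Cons False) (decode t (\<lambda>i. y (Suc i)))))"
| "decode (Times t u) y = Node (map_resp (Cons False) (decode t (\<lambda>i. y (2 * i))))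
     (map_resp (Cons True) (decode u (\<lambda>i. y (Suc (2 * i)))))"

text \<open>Only tag bits are inspected, and these do not depend on the leaf contents.\<close>

lemma decode_den: "a \<in> answers t \<Longrightarrow> decode t (den s a) = a"
  by (induction t arbitrary: a s) (auto simp: den_map_resp)

text \<open>Decoding branches on bits at fixed positions, to a depth bounded by the term.
  \<open>k\<close> tracks where the bits of the current subterm lie in \<open>z\<close>, and the
  arbitrary continuation \<open>\<Phi>\<close> carries what is done with the result through the
  induction.\<close>

lemma lin_computable_decode:
  assumes "\<And>a. lin_computable (\<Phi> a)"
  shows "lin_computable (\<lambda>z. \<Phi> (decode u (\<lambda>i. z (k i))) z)"
  using assms
proof (induction u arbitrary: k \<Phi>)
  case (Meet t u)
  have "lin_computable (\<lambda>z. if z (k 0)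
      then \<Phi> (Tag True (map_resp (Cons True) (decode u (\<lambda>i. z (k (Suc i)))))) z
      else \<Phi> (Tag False (map_resp (Cons False) (decode t (\<lambda>i. z (k (Suc i)))))) z)"
    by (intro lin_computable_if_bit
        Meet.IH(1)[where \<Phi> = "\<lambda>a. \<Phi> (Tag False (map_resp (Cons False) a))"]
        Meet.IH(2)[where \<Phi> = "\<lambda>a. \<Phi> (Tag True (map_resp (Cons True) a))"] Meet.prems)
  moreover have "(\<lambda>z. \<Phi> (decode (Meet t u) (\<lambda>i. z (k i))) z) = (\<lambda>z. if z (k 0)
      then \<Phi> (Tag True (map_resp (Cons True) (decode u (\<lambda>i. z (k (Suc i)))))) z
      else \<Phi> (Tag False (map_resp (Cons False) (decode t (\<lambda>i. z (k (Suc i)))))) z)"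
    by auto
  ultimately show ?case by simp
next
  case (Times t u)
  \<comment> \<open>First the right factor is decoded with the left answer held fixed; the result
    then serves as continuation for decoding the left factor.\<close>
  have "lin_computable (\<lambda>z. \<Phi> (Node (map_resp (Cons False) a)
      (map_resp (Cons True) (decode u (\<lambda>i. z (k (Suc (2 * i))))))) z)" for a
    by (rule Times.IH(2)[where \<Phi> = "\<lambda>b. \<Phi> (Node (map_resp (Cons False) a) (map_resp (Cons True) b))",
          OF Times.prems])
  from Times.IH(1)[where \<Phi> = "\<lambda>a z. \<Phi> (Node (map_resp (Cons False) a)
      (map_resp (Cons True) (decode u (\<lambda>i. z (k (Suc (2 * i))))))) z", OF this]
  show ?case by simp
qed simp

lemma lin_computable_den:
  "(\<And>v. v \<in> set_resp a \<Longrightarrow> lin_computable (S v)) \<Longrightarrow> lin_computable (\<lambda>z. den (\<lambda>v. S v z) a)"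
  by (induction a) (auto intro: lin_computable_ccons lin_computable_cpair)

lemma lin_computable_assemble:
  "(\<And>v. v \<in> verts (tgraph t) \<Longrightarrow> lin_computable (S v)) \<Longrightarrow> lin_computable (\<lambda>z. assemble t (\<lambda>v. S v z))"
proof (induction t arbitrary: S)
  case (Meet t u)
  then show ?case
    using Meet.IH(1)[of "\<lambda>v. S (False # v)"] Meet.IH(2)[of "\<lambda>v. S (True # v)"]
    by (auto simp: comp_def intro: lin_computable_cpair)
next
  case (Times t u)
  then show ?case
    using Times.IH(1)[of "\<lambda>v. S (False # v)"] Times.IH(2)[of "\<lambda>v. S (True # v)"]
    by (auto simp: comp_def intro: lin_computable_cpair)
qed simp

section \<open>From reductions to Weihrauch reducibility\<close>

text \<open>Computable points are requested only where \<open>f\<close> is undefined, so that total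
  and partial reductions are treated together.\<close>

lemma W_le_of_bullet_reduction:
  fixes t u :: "'v trm"
  assumes f: "bullet_reduction (tgraph t) (tgraph u) f"
    and points: "\<And>v. v \<in> verts (tgraph u) \<Longrightarrow> f v = None \<Longrightarrow>
      \<exists>p\<in>mdom (\<alpha> (col (tgraph u) v)). comp_fn 1 (\<lambda>xs. of_bool (p (xs ! 0)))"
  shows "W_le (evalW \<alpha> t) (evalW \<alpha> u)"
proof -
  have ran_f: "\<And>v w. f v = Some w \<Longrightarrow> w \<in> verts (tgraph t)"
    and col_f: "\<And>v w. f v = Some w \<Longrightarrow> col (tgraph t) w = col (tgraph u) v"
    and cliques: "\<And>M. max_clique (tgraph u) M \<Longrightarrow>
      \<exists>C. max_clique (tgraph t) C \<and> C \<subseteq> {w. \<exists>v\<in>M. f v = Some w}"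
    using f unfolding bullet_reduction_def by (auto intro: ranI) (metis domI option.sel)
  obtain c where c: "\<And>v. v \<in> verts (tgraph u) \<Longrightarrow> f v = None \<Longrightarrow>
      c v \<in> mdom (\<alpha> (col (tgraph u) v)) \<and> comp_fn 1 (\<lambda>xs. of_bool (c v (xs ! 0)))"
    using points by metis
  define h where "h v z = (case f v of Some w \<Rightarrow> component t z w | None \<Rightarrow> c v)" for v z
  define H where "H z = assemble u (\<lambda>v. h v z)" for z
  have "lin_computable (h v)" if "v \<in> verts (tgraph u)" for v
  proof (cases "f v")
    case None
    then show ?thesis
      using c[OF that None] lin_computable_const by (simp add: h_def[abs_def])
  next
    case (Some w)
    obtain A B where "\<And>z n. component t z w n = z (A * n + B)"
      using component_position by blast
    then have "h v = (\<lambda>z n. z (A * n + B))" using Some by (intro ext) (simp add: h_def)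
    then show ?thesis by (simp add: lin_computable_affine)
  qed
  then have H: "lin_computable H"
    unfolding H_def[abs_def] by (rule lin_computable_assemble)
  have H_dom: "H x \<in> mdom (evalW \<alpha> u)" if "x \<in> mdom (evalW \<alpha> t)" for x
    unfolding mdom_evalW
  proof
    fix v assume v: "v \<in> verts (tgraph u)"
    have "h v x \<in> mdom (\<alpha> (col (tgraph u) v))"
      using that ran_f col_f c[OF v] unfolding mdom_evalW h_def by (force split: option.split)
    then show "component u (H x) v \<in> mdom (\<alpha> (col (tgraph u) v))"
      unfolding H_def component_assemble[OF v] .
  qed
  \<comment> \<open>The choices \<open>sel\<close> and \<open>pre\<close> made from here on need not
    be effective: \<open>decode\<close> has finitely many outcomes, and for each of them the choice
    is a constant built into \<open>K\<close>.\<close>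
  have "\<exists>b\<in>answers t. \<forall>w\<in>set_resp b. \<exists>v\<in>set_resp a. f v = Some w" if "a \<in> answers u" for a
    using cliques[of "set_resp a"] that unfolding max_clique_iff_answer by blast
  then obtain sel where sel: "\<And>a. a \<in> answers u \<Longrightarrow> sel a \<in> answers t"
    and ex_pre: "\<And>a w. a \<in> answers u \<Longrightarrow> w \<in> set_resp (sel a) \<Longrightarrow> \<exists>v\<in>set_resp a. f v = Some w"
    by metis
  from ex_pre obtain pre where pre: "\<And>a w. a \<in> answers u \<Longrightarrow> w \<in> set_resp (sel a) \<Longrightarrow>
      pre a w \<in> set_resp a \<and> f (pre a w) = Some w"
    by metis
  obtain A B where AB: "\<And>(a :: bool list resp) v s n. v \<in> set_resp a \<Longrightarrow> den s a (A a v * n + B a v) = s v n"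
    using leaf_position by metis
  \<comment> \<open>In \<open>cpair x y\<close> the bits of \<open>y\<close> sit at the odd
    positions, so position \<open>A * n + B\<close> of \<open>y\<close> becomes
    \<open>2 * (A * n + B) + 1\<close>.\<close>
  define leaf where "leaf a w z = (\<lambda>n. z (2 * A a (pre a w) * n + (2 * B a (pre a w) + 1)))"
    for a w and z :: cantor
  define K where "K z = (let a = decode u (\<lambda>i. z (2 * i + 1)) in den (\<lambda>w. leaf a w z) (sel a))"
    for z
  have "lin_computable (\<lambda>z. den (\<lambda>w. leaf a w z) (sel a))" for a
    by (intro lin_computable_den) (simp only: leaf_def[abs_def] lin_computable_affine)
  from lin_computable_decode[where \<Phi> = "\<lambda>a z. den (\<lambda>w. leaf a w z) (sel a)", OF this]
  have K: "lin_computable K" unfolding K_def[abs_def] Let_def .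
  have "K (cpair x y) \<in> evalW \<alpha> t x" if x: "x \<in> mdom (evalW \<alpha> t)" and y: "y \<in> evalW \<alpha> u (H x)" for x y
  proof -
    obtain a s where a: "a \<in> answers u" and y_eq: "y = den s a"
      and s: "\<And>v. v \<in> set_resp a \<Longrightarrow> s v \<in> \<alpha> (col (tgraph u) v) (component u (H x) v)"
      using y unfolding evalW_iff_answer[OF H_dom[OF x]] by blast
    have "decode u (\<lambda>i. cpair x y (2 * i + 1)) = a"
      using decode_den[OF a] by (simp add: y_eq)
    then have K_eq: "K (cpair x y) = den (\<lambda>w. leaf a w (cpair x y)) (sel a)"
      by (simp add: K_def)
    have "leaf a w (cpair x y) \<in> \<alpha> (col (tgraph t) w) (component t x w)"
      if w: "w \<in> set_resp (sel a)" for w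
    proof -
      let ?v = "pre a w"
      have v: "?v \<in> set_resp a" "f ?v = Some w" using pre[OF a w] by auto
      have "2 * A a ?v * n + (2 * B a ?v + 1) = Suc (2 * (A a ?v * n + B a ?v))" for n by simp
      then have "leaf a w (cpair x y) = s ?v"
        unfolding leaf_def by (simp only: cpair_index y_eq AB[OF v(1)])
      moreover have "?v \<in> verts (tgraph u)" using set_resp_answers[OF a] v by blast
      then have "component u (H x) ?v = component t x w"
        unfolding H_def by (simp add: component_assemble h_def v)
      ultimately show ?thesis using s[OF v(1)] col_f[OF v(2)] by simp
    qed
    then show ?thesis
      unfolding evalW_iff_answer[OF x] K_eq using sel[OF a]
      by (intro bexI[of _ "sel a"] exI[of _ "\<lambda>w. leaf a w (cpair x y)"]) auto
  qed
  then show ?thesis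
    unfolding W_le_def
    using H_dom lin_computable_imp_computable_on[OF H] lin_computable_imp_computable_on[OF K] by blast
qed

section \<open>From Weihrauch reducibility to reductions\<close>

text \<open>The condition of \<open>computable_on\<close> at a single point, with the word function
  made explicit so that it can be diagonalised against.\<close>

definition computes :: "(bool list \<Rightarrow> bool list) \<Rightarrow> cantor \<Rightarrow> cantor \<Rightarrow> bool" where
  "computes \<phi> x y \<longleftrightarrow> (\<forall>m i. i < length (\<phi> (prefix_of x m)) \<longrightarrow> \<phi> (prefix_of x m) ! i = y i)
     \<and> (\<forall>n. \<exists>m. n \<le> length (\<phi> (prefix_of x m)))"

text \<open>\<open>None\<close> labels the trivial instance, whose solution is the zero sequence;
  \<open>Some v\<close> labels the generic column at \<open>v\<close>.\<close>

definition label_val :: "('l \<times> nat \<Rightarrow> bool) \<Rightarrow> 'l option \<Rightarrow> cantor" where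
  "label_val Q l = (case l of None \<Rightarrow> (\<lambda>_. False) | Some v \<Rightarrow> (\<lambda>n. Q (v, n)))"

text \<open>Either some extension of \<open>\<sigma>\<close> makes \<open>\<phi>\<close> emit the output bit that should equal an undecided
  bit of \<open>Q v\<close>; the input bits it used do not involve \<open>v\<close>, so they can be frozen and the bit of
  \<open>Q v\<close> set to the opposite value. Or no extension does, and \<open>\<sigma>\<close> itself suffices.\<close>
lemma avoid_computation:
  fixes \<sigma> :: "'l \<times> nat \<rightharpoonup> bool"
  assumes \<sigma>: "finite (dom \<sigma>)" and v: "v \<in> set_resp b" "Some v \<notin> set_resp a"
  shows "\<exists>\<tau>. finite (dom \<tau>) \<and> \<sigma> \<subseteq>\<^sub>m \<tau> \<and> (\<forall>Q. extends Q \<tau> \<longrightarrow>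
    \<not> computes \<phi> (cpair x (den (label_val Q) a)) (den (\<lambda>v n. Q (v, n)) b))"
proof -
  define Y where "Y Q = cpair x (den (label_val Q) a)" for Q :: "'l \<times> nat \<Rightarrow> bool"
  obtain A B where AB: "\<And>s n. den s b (A * n + B) = s v n"
    using leaf_position[OF v(1)] by blast
  \<comment> \<open>A finite condition leaves some bit of column \<open>v\<close> undecided; that
    bit is the one to be set against \<open>\<phi>\<close>.\<close>
  have "finite ((\<lambda>n. (v, n)) -` dom \<sigma>)"
    by (intro finite_vimageI \<sigma>) (simp add: inj_on_def)
  then obtain n where "n \<notin> (\<lambda>n. (v, n)) -` dom \<sigma>"
    using ex_new_if_finite[OF infinite_UNIV_nat] by metis
  then have n: "(v, n) \<notin> dom \<sigma>" by (simp only: vimage_eq not_False_eq_True)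
  \<comment> \<open>Each input bit comes from the fixed \<open>x\<close>, a tag, a trivial leaf, or
    one entry of a column other than \<open>v\<close>; hence a finite prefix depends on finitely
    many entries, all outside column \<open>v\<close>.\<close>
  have bit: "\<exists>D. finite D \<and> (\<forall>q\<in>D. fst q \<noteq> v) \<and> (\<forall>Q Q'. (\<forall>q\<in>D. Q q = Q' q) \<longrightarrow> Y Q i = Y Q' i)" for i
  proof (cases "even i")
    case True
    then show ?thesis by (intro exI[of _ "{}"]) (simp add: Y_def cpair_def)
  next
    case False
    then have Y: "Y Q i = den (label_val Q) a (i div 2)" for Q by (simp add: Y_def cpair_def)
    show ?thesis
    proof (cases "\<exists>c. \<forall>s. den s a (i div 2) = c")
      case True
      then obtain c where "\<And>s. den s a (i div 2) = c" by blast
      then show ?thesis unfolding Y by (intro exI[of _ "{}"]) simp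
    next
      case False
      with den_bit_dependence[of a "i div 2"]
      have "\<exists>l\<in>set_resp a. \<exists>j. \<forall>s. den s a (i div 2) = s l j" by (simp only: simp_thms)
      then obtain l j where l: "l \<in> set_resp a" and "\<forall>s. den s a (i div 2) = s l j"
        by (elim bexE exE)
      then have l_eq: "den s a (i div 2) = s l j" for s by (elim allE)
      show ?thesis
      proof (cases l)
        case None
        then show ?thesis unfolding Y l_eq by (intro exI[of _ "{}"]) (simp add: label_val_def)
      next
        case (Some w)
        then have "w \<noteq> v" using l v(2) by blast
        then show ?thesis
          unfolding Y l_eq by (intro exI[of _ "{(w, j)}"]) (simp add: label_val_def Some)
      qed
    qed
  qed
  have pref: "\<exists>D. finite D \<and> (\<forall>q\<in>D. fst q \<noteq> v) \<and>
      (\<forall>Q Q'. (\<forall>q\<in>D. Q q = Q' q) \<longrightarrow> prefix_of (Y Q) m = prefix_of (Y Q') m)" for m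
  proof -
    obtain D where D: "\<And>i. finite (D i)" "\<And>i. \<forall>q\<in>D i. fst q \<noteq> v"
      "\<And>i Q Q'. \<forall>q\<in>D i. Q q = Q' q \<Longrightarrow> Y Q i = Y Q' i"
      using bit by metis
    show ?thesis
      using D by (intro exI[of _ "\<Union>i<m. D i"]) (auto simp: prefix_of_def)
  qed
  show ?thesis
  proof (cases "\<exists>Q m. extends Q \<sigma> \<and> A * n + B < length (\<phi> (prefix_of (Y Q) m))")
    case False
    have "\<not> computes \<phi> (Y Q) (den (\<lambda>v n. Q (v, n)) b)" if "extends Q \<sigma>" for Q
      using False that unfolding computes_def by (metis Suc_le_eq)
    then show ?thesis using \<sigma> unfolding Y_def by (intro exI[of _ \<sigma>]) auto
  next
    case True
    then obtain Q m where Q: "extends Q \<sigma>" and m: "A * n + B < length (\<phi> (prefix_of (Y Q) m))"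
      by blast
    obtain D where D: "finite D" "\<forall>q\<in>D. fst q \<noteq> v"
      "\<And>Q'. \<forall>q\<in>D. Q q = Q' q \<Longrightarrow> prefix_of (Y Q) m = prefix_of (Y Q') m"
      using pref[of m] by metis
    define \<tau> where "\<tau> q = (if q = (v, n) then Some (\<not> \<phi> (prefix_of (Y Q) m) ! (A * n + B))
      else if q \<in> D then Some (Q q) else \<sigma> q)" for q
    have "dom \<tau> \<subseteq> insert (v, n) (D \<union> dom \<sigma>)" by (auto simp: \<tau>_def dom_def split: if_splits)
    then have "finite (dom \<tau>)" using D(1) \<sigma> by (meson finite.insertI finite_UnI finite_subset)
    moreover have "\<sigma> \<subseteq>\<^sub>m \<tau>"
      using Q n by (auto simp: map_le_def \<tau>_def extends_def)
    moreover have "\<not> computes \<phi> (Y Q') (den (\<lambda>v n. Q' (v, n)) b)" if Q': "extends Q' \<tau>" for Q'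
    proof
      assume c: "computes \<phi> (Y Q') (den (\<lambda>v n. Q' (v, n)) b)"
      have "Q' q = Q q" if "q \<in> D" for q
        using Q' that D(2) unfolding extends_def \<tau>_def by (metis fst_conv)
      then have "prefix_of (Y Q) m = prefix_of (Y Q') m" by (intro D(3)) simp
      then have "\<phi> (prefix_of (Y Q) m) ! (A * n + B) = Q' (v, n)"
        using c m AB[of "\<lambda>v n. Q' (v, n)" n] unfolding computes_def by metis
      moreover have "Q' (v, n) = (\<not> \<phi> (prefix_of (Y Q) m) ! (A * n + B))"
        using Q' unfolding extends_def \<tau>_def by simp
      ultimately show False by simp
    qed
    ultimately show ?thesis unfolding Y_def by blast
  qed
qed

text \<open>There is one requirement for each word function and each pair of shapes violating the
  inclusion. These are countably many, and \<open>avoid_computation\<close> shows that each can be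
  met by a finite extension. The point \<open>x\<close> is fixed before \<open>Q\<close> is
  chosen.\<close>

lemma independent_family_exists:
  "\<exists>Q :: 'l::countable \<times> nat \<Rightarrow> bool. \<forall>\<phi> a b. computable_word \<phi> \<longrightarrow>
     computes \<phi> (cpair x (den (label_val Q) a)) (den (\<lambda>v n. Q (v, n)) b) \<longrightarrow>
     Some ` set_resp b \<subseteq> set_resp a"
proof -
  define bad where "bad = (\<lambda>(\<phi>, a, b). {Q :: 'l \<times> nat \<Rightarrow> bool.
    computes \<phi> (cpair x (den (label_val Q) a)) (den (\<lambda>v n. Q (v, n)) b)})"
  define I where "I = {\<phi>. computable_word \<phi>}
    \<times> {(a, b :: 'l resp). \<not> Some ` set_resp b \<subseteq> set_resp a}"
  have "countable (bad ` I)"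
    unfolding I_def by (intro countable_image countable_SIGMA countable_computable_word) simp
  then have "\<exists>Q. Q \<notin> \<Union>(bad ` I)"
  proof (rule generic_exists)
    fix S and \<sigma> :: "'l \<times> nat \<rightharpoonup> bool" assume "S \<in> bad ` I" and \<sigma>: "finite (dom \<sigma>)"
    then obtain \<phi> a b v where "S = bad (\<phi>, a, b)" and "v \<in> set_resp b" "Some v \<notin> set_resp a"
      unfolding I_def by blast
    then show "\<exists>\<tau>. finite (dom \<tau>) \<and> \<sigma> \<subseteq>\<^sub>m \<tau> \<and> (\<forall>Q. extends Q \<tau> \<longrightarrow> Q \<notin> S)"
      using avoid_computation[OF \<sigma>, of v b a \<phi> x] by (simp add: bad_def)
  qed
  then show ?thesis unfolding bad_def I_def by blast
qed

section \<open>The generic assignment and the reduction it forces\<close>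

lemma comp_fn_zero_point: "comp_fn 1 (\<lambda>xs. of_bool False)"
  using comp_fn_const[of 1 0] by simp

lemma pointedI_zero:
  assumes "(\<lambda>_. False) \<in> mdom f"
  shows "pointed f"
  unfolding pointed_def W_le_def
proof (intro exI conjI ballI)
  show "computable_on (mdom idW) (\<lambda>_ _. False)"
    by (rule lin_computable_imp_computable_on[OF lin_computable_const[OF comp_fn_zero_point]])
  have "cfst = (\<lambda>z n. z (2 * n + 0))" by (auto simp: cfst_def)
  then show "computable_on D cfst" for D
    using lin_computable_imp_computable_on[OF lin_computable_affine[of 2 0]] by metis
  fix x y
  show "(\<lambda>_. False) \<in> mdom f" by (fact assms)
  show "cfst (cpair x y) \<in> idW x" by (simp add: idW_def)
qed

text \<open>The flag \<open>P\<close> merges both parts of the theorem: when it holds, every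
  variable also receives the trivial instance and so is pointed; when it fails, \<open>f\<close> is
  forced to be total.\<close>

lemma bullet_reduction_of_W_le:
  fixes t u :: "'v trm"
  assumes "\<And>\<alpha>. (P \<Longrightarrow> \<forall>x. pointed (\<alpha> x)) \<Longrightarrow> W_le (evalW \<alpha> t) (evalW \<alpha> u)"
  shows "\<exists>f. bullet_reduction (tgraph t) (tgraph u) f \<and> (\<not> P \<longrightarrow> dom f = verts (tgraph u))"
proof -
  \<comment> \<open>Names are characteristic sequences of singletons: pairwise distinct, and
    distinct from the zero sequence, which is reserved for the trivial instance.\<close>
  define p :: "bool list \<Rightarrow> cantor" where "p v = (\<lambda>n. n = wcode v)" for v
  have p_inj: "p v = p w \<Longrightarrow> v = w" for v w
    using injD[OF inj_wcode] unfolding p_def by metis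
  have p_nonzero: "p v \<noteq> (\<lambda>_. False)" for v unfolding p_def by metis
  define z where "z = assemble t p"
  obtain Q where Q: "\<And>\<phi> a b. computable_word \<phi> \<Longrightarrow>
      computes \<phi> (cpair z (den (label_val Q) a)) (den (\<lambda>(v :: bool list) n. Q (v, n)) b) \<Longrightarrow>
      Some ` set_resp b \<subseteq> set_resp a"
    using independent_family_exists[of z] by blast
  \<comment> \<open>The dummy binder of type \<open>unit\<close> only serves to write a singleton
    that is present exactly when \<open>P\<close> holds and \<open>q\<close> is zero.\<close>
  define \<alpha> :: "'v \<Rightarrow> mvf" where "\<alpha> x q = {label_val Q (Some v) | v.
       v \<in> verts (tgraph t) \<and> col (tgraph t) v = x \<and> q = p v}
     \<union> {label_val Q None | _::unit. P \<and> q = (\<lambda>_. False)}" for x q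
  have \<alpha>_p: "\<alpha> (col (tgraph t) v) (p v) = {label_val Q (Some v)}" if "v \<in> verts (tgraph t)" for v
    using that p_inj p_nonzero[of v] by (auto simp: \<alpha>_def)
  have "pointed (\<alpha> x)" if P for x
    by (rule pointedI_zero) (auto simp: mdom_def \<alpha>_def that)
  then have "W_le (evalW \<alpha> t) (evalW \<alpha> u)" by (intro assms) blast
  then obtain H K where K: "computable_on {cpair x y | x y. x \<in> mdom (evalW \<alpha> t) \<and> y \<in> evalW \<alpha> u (H x)} K"
    and HK: "\<And>x. x \<in> mdom (evalW \<alpha> t) \<Longrightarrow> H x \<in> mdom (evalW \<alpha> u)"
      "\<And>x y. x \<in> mdom (evalW \<alpha> t) \<Longrightarrow> y \<in> evalW \<alpha> u (H x) \<Longrightarrow> K (cpair x y) \<in> evalW \<alpha> t x"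
    unfolding W_le_def by blast
  obtain \<phi> where \<phi>: "computable_word \<phi>"
    and \<phi>K: "\<And>x y. x \<in> mdom (evalW \<alpha> t) \<Longrightarrow> y \<in> evalW \<alpha> u (H x) \<Longrightarrow>
      computes \<phi> (cpair x y) (K (cpair x y))"
    using K unfolding computable_on_def computes_def by blast
  have comp_z: "component t z v = p v" if "v \<in> verts (tgraph t)" for v
    unfolding z_def by (rule component_assemble[OF that])
  have z: "z \<in> mdom (evalW \<alpha> t)"
    unfolding mdom_evalW using comp_z \<alpha>_p by (simp add: mdom_def)
  \<comment> \<open>\<open>f w\<close> is the vertex whose name \<open>H\<close> places at
    \<open>w\<close>. If there is none, \<open>H\<close> must have placed the trivial instance
    there. Colours match because the problem at \<open>w\<close> accepts only names of vertices of
    its own colour.\<close>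
  define f where "f w = (if w \<in> verts (tgraph u) \<and>
      (\<exists>v\<in>verts (tgraph t). component u (H z) w = p v)
    then Some (THE v. component u (H z) w = p v) else None)" for w
  have f_eq: "f w = Some v" if "w \<in> verts (tgraph u)" "v \<in> verts (tgraph t)" "component u (H z) w = p v"
    for v w
  proof -
    have "(THE v. component u (H z) w = p v) = v" using that(3) p_inj by (intro the_equality) auto
    then show ?thesis using that unfolding f_def by auto
  qed
  have f_val: "label_val Q (f w) \<in> \<alpha> (col (tgraph u) w) (component u (H z) w)"
    and f_col: "\<And>v. f w = Some v \<Longrightarrow> v \<in> verts (tgraph t) \<and> col (tgraph t) v = col (tgraph u) w"
    and f_total: "\<not> P \<Longrightarrow> f w \<noteq> None"
    if w: "w \<in> verts (tgraph u)" for w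
  proof -
    have "component u (H z) w \<in> mdom (\<alpha> (col (tgraph u) w))"
      using HK(1)[OF z] w unfolding mdom_evalW by blast
    then consider v where "v \<in> verts (tgraph t)" "col (tgraph t) v = col (tgraph u) w"
        "component u (H z) w = p v"
      | P "component u (H z) w = (\<lambda>_. False)"
      unfolding mdom_def \<alpha>_def by blast
    then have "label_val Q (f w) \<in> \<alpha> (col (tgraph u) w) (component u (H z) w)
      \<and> (\<forall>v. f w = Some v \<longrightarrow> v \<in> verts (tgraph t) \<and> col (tgraph t) v = col (tgraph u) w)
      \<and> (\<not> P \<longrightarrow> f w \<noteq> None)"
    proof cases
      case 1
      then show ?thesis using f_eq[OF w 1(1,3)] \<alpha>_p[of v] by auto
    next
      case 2
      then have "f w = None" unfolding f_def by (metis p_nonzero)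
      then show ?thesis using 2 by (auto simp: \<alpha>_def)
    qed
    then show "label_val Q (f w) \<in> \<alpha> (col (tgraph u) w) (component u (H z) w)"
      "\<And>v. f w = Some v \<Longrightarrow> v \<in> verts (tgraph t) \<and> col (tgraph t) v = col (tgraph u) w"
      "\<not> P \<Longrightarrow> f w \<noteq> None" by blast+
  qed
  have dom_f: "dom f \<subseteq> verts (tgraph u)" by (auto simp: f_def split: if_splits)
  have "\<exists>C. max_clique (tgraph t) C \<and> C \<subseteq> {v. \<exists>w\<in>M. f w = Some v}" if M: "max_clique (tgraph u) M" for M
  proof -
    obtain a where a: "a \<in> answers u" "M = set_resp a"
      using M unfolding max_clique_iff_answer by blast
    \<comment> \<open>The solution of the instance \<open>H z\<close> with clique \<open>M\<close>:
      each leaf \<open>w\<close> carries the sequence labelled \<open>f w\<close>.\<close>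
    let ?y = "den (label_val Q) (map_resp f a)"
    have y: "?y \<in> evalW \<alpha> u (H z)"
      unfolding evalW_iff_answer[OF HK(1)[OF z]] den_map_resp
      using a(1) f_val set_resp_answers[OF a(1)]
      by (intro bexI[of _ a] exI[of _ "label_val Q \<circ> f"]) auto
    obtain b s where b: "b \<in> answers t" and K_eq: "K (cpair z ?y) = den s b"
      and s: "\<And>v. v \<in> set_resp b \<Longrightarrow> s v \<in> \<alpha> (col (tgraph t) v) (component t z v)"
      using HK(2)[OF z y] unfolding evalW_iff_answer[OF z] by blast
    have "s v = (\<lambda>n. Q (v, n))" if "v \<in> set_resp b" for v
    proof -
      have "v \<in> verts (tgraph t)" using set_resp_answers[OF b] that by blast
      then show ?thesis using s[OF that] comp_z \<alpha>_p by (simp add: label_val_def)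
    qed
    then have "den s b = den (\<lambda>v n. Q (v, n)) b" by (rule den_cong)
    \<comment> \<open>\<open>K\<close> computes the columns on the clique of \<open>b\<close> from
      \<open>z\<close> and the columns labelled by \<open>f\<close> on \<open>M\<close>; by
      independence each of the former occurs among the latter.\<close>
    then have "Some ` set_resp b \<subseteq> set_resp (map_resp f a)"
      using Q[OF \<phi>] \<phi>K[OF z y] K_eq by simp
    then have "set_resp b \<subseteq> {v. \<exists>w\<in>M. f w = Some v}"
      unfolding a(2) resp.set_map by (auto simp: image_iff subset_iff) metis
    then show ?thesis using b max_clique_iff_answer by blast
  qed
  then have "bullet_reduction (tgraph t) (tgraph u) f"
    unfolding bullet_reduction_def using dom_f f_col by (fastforce simp: ran_def)
  moreover have "dom f = verts (tgraph u)" if "\<not> P"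
    using dom_f f_total[OF _ that] by blast
  ultimately show ?thesis by blast
qed

theorem mainTheorem2:
  fixes t u :: "'v trm"
  shows "(univ_valid t u \<longleftrightarrow> (\<exists>f. reduction (tgraph t) (tgraph u) f))
       \<and> (univ_valid_pointed t u \<longleftrightarrow> (\<exists>f. bullet_reduction (tgraph t) (tgraph u) f))"
proof (intro conjI iffI)
  assume "univ_valid t u"
  then show "\<exists>f. reduction (tgraph t) (tgraph u) f"
    using bullet_reduction_of_W_le[of False t u] unfolding univ_valid_def reduction_def by blast
next
  assume "\<exists>f. reduction (tgraph t) (tgraph u) f"
  then obtain f where "bullet_reduction (tgraph t) (tgraph u) f" "dom f = verts (tgraph u)"
    unfolding reduction_def by blast
  \<comment> \<open>Totality of \<open>f\<close> discharges the request for computable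
    points.\<close>
  then show "univ_valid t u"
    unfolding univ_valid_def using W_le_of_bullet_reduction by (metis domIff)
next
  assume "univ_valid_pointed t u"
  then show "\<exists>f. bullet_reduction (tgraph t) (tgraph u) f"
    using bullet_reduction_of_W_le[of True t u] unfolding univ_valid_pointed_def by blast
next
  assume "\<exists>f. bullet_reduction (tgraph t) (tgraph u) f"
  \<comment> \<open>Pointedness supplies a computable instance wherever \<open>f\<close> is
    undefined.\<close>
  then show "univ_valid_pointed t u"
    unfolding univ_valid_pointed_def
    using W_le_of_bullet_reduction pointed_imp_computable_point by metis
qed

end
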